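(* \textsc{2-Colored $P_4$ Deletion} can be solved in $\mathcal{O}(nm)$ time on input graphs belonging to $\mathcal{T}$, where $n$ and $m$ are the numbers of vertices and edges.
   Context: A bicolored graph has each edge colored blue or red. A bicolored $P_4$ is a path on four vertices containing edges of both colors. \textsc{2-Colored $P_4$ Deletion}: given a bicolored graph $G$ and integer $k$, decide whether some set $S$ of at most $k$ edges makes $G-S$ free of induced bicolored $P_4$s. $\mathcal{T}$ is the class of bicolored graphs containing none of the following as an induced subgraph (colors preserved): a path on three vertices with two blue edges; a path on three vertices with two red edges; a triangle with two blue and one red edge; a triangle with two red and one blue edge; a path on four vertices with consecutive edge colors red, blue, red. *)

theory Defs
  imports Main
begin

datatype colour = Blue | Red

text \<open>A simple graph whose edge set is split into its blue and its red edges; an edge is a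
  two-element set of vertices.\<close>

record 'a bgraph =
  verts :: "'a set"
  blue :: "'a set set"
  red :: "'a set set"

definition edges :: "'a bgraph \<Rightarrow> 'a set set" where
  "edges G = blue G \<union> red G"

definition bicolored_graph :: "'a bgraph \<Rightarrow> bool" where
  "bicolored_graph G \<longleftrightarrow>
     finite (verts G) \<and> (\<forall>e\<in>edges G. e \<subseteq> verts G \<and> card e = 2) \<and> blue G \<inter> red G = {}"

definition delete_edges :: "'a bgraph \<Rightarrow> 'a set set \<Rightarrow> 'a bgraph" where
  "delete_edges G S = \<lparr>verts = verts G, blue = blue G - S, red = red G - S\<rparr>"

text \<open>\<open>G\<close> has an induced subgraph isomorphic to \<open>H\<close> by a colour-preserving isomorphism.\<close>

definition contains_induced :: "'a bgraph \<Rightarrow> 'b bgraph \<Rightarrow> bool" where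
  "contains_induced G H \<longleftrightarrow>
     (\<exists>f. inj_on f (verts H) \<and> f ` verts H \<subseteq> verts G \<and>
       (\<forall>x\<in>verts H. \<forall>y\<in>verts H.
          ({f x, f y} \<in> blue G \<longleftrightarrow> {x, y} \<in> blue H) \<and>
          ({f x, f y} \<in> red G \<longleftrightarrow> {x, y} \<in> red H)))"

text \<open>The path whose consecutive edges have the colours \<open>cs\<close>.\<close>

definition path_graph :: "colour list \<Rightarrow> nat bgraph" where
  "path_graph cs =
     \<lparr>verts = {0..length cs},
      blue = {{i, Suc i} |i. i < length cs \<and> cs ! i = Blue},
      red = {{i, Suc i} |i. i < length cs \<and> cs ! i = Red}\<rparr>"

definition triangle_BBR :: "nat bgraph" where
  "triangle_BBR = \<lparr>verts = {0, 1, 2}, blue = {{0, 1}, {1, 2}}, red = {{0, 2}}\<rparr>"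

definition triangle_RRB :: "nat bgraph" where
  "triangle_RRB = \<lparr>verts = {0, 1, 2}, blue = {{0, 2}}, red = {{0, 1}, {1, 2}}\<rparr>"

definition class_T :: "'a bgraph set" where
  "class_T = {G. bicolored_graph G \<and>
     \<not> contains_induced G (path_graph [Blue, Blue]) \<and>
     \<not> contains_induced G (path_graph [Red, Red]) \<and>
     \<not> contains_induced G triangle_BBR \<and>
     \<not> contains_induced G triangle_RRB \<and>
     \<not> contains_induced G (path_graph [Red, Blue, Red])}"

definition bicolored_P4_free :: "'a bgraph \<Rightarrow> bool" where
  "bicolored_P4_free G \<longleftrightarrow>
     (\<forall>cs. length cs = 3 \<and> Blue \<in> set cs \<and> Red \<in> set cs \<longrightarrow>
        \<not> contains_induced G (path_graph cs))"

definition two_colored_P4_deletion :: "'a bgraph \<Rightarrow> int \<Rightarrow> bool" where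
  "two_colored_P4_deletion G k \<longleftrightarrow>
     (\<exists>S \<subseteq> edges G. int (card S) \<le> k \<and> bicolored_P4_free (delete_edges G S))"

text \<open>Unit-cost random access machine with structured control flow. A state consists of the
  registers and the main memory, both holding integers. A program is a fixed piece of syntax, so
  it uses finitely many registers; main memory is accessed through addresses held in registers.
  Every instruction and every evaluation of a test takes one time step. Addition and subtraction
  are the only arithmetic operations, and access to a negative address has no transition.\<close>

datatype ram =
    Const nat int
  | Move nat nat
  | Add nat nat nat
  | Sub nat nat nat
  | Load nat nat
  | Store nat nat
  | Seq ram ram
  | IfLess nat nat ram ram
  | WhileLess nat nat ram

type_synonym state = "(nat \<Rightarrow> int) \<times> (nat \<Rightarrow> int)"

inductive exec :: "ram \<Rightarrow> state \<Rightarrow> nat \<Rightarrow> state \<Rightarrow> bool" where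
  Const: "exec (Const i c) (r, M) 1 (r(i := c), M)"
| Move: "exec (Move i j) (r, M) 1 (r(i := r j), M)"
| Add: "exec (Add i j l) (r, M) 1 (r(i := r j + r l), M)"
| Sub: "exec (Sub i j l) (r, M) 1 (r(i := r j - r l), M)"
| Load: "r j \<ge> 0 \<Longrightarrow> exec (Load i j) (r, M) 1 (r(i := M (nat (r j))), M)"
| Store: "r i \<ge> 0 \<Longrightarrow> exec (Store i j) (r, M) 1 (r, M(nat (r i) := r j))"
| Seq: "exec p s t s' \<Longrightarrow> exec q s' t' s'' \<Longrightarrow> exec (Seq p q) s (t + t') s''"
| IfTrue: "r i < r j \<Longrightarrow> exec p (r, M) t s' \<Longrightarrow> exec (IfLess i j p q) (r, M) (1 + t) s'"
| IfFalse: "\<not> r i < r j \<Longrightarrow> exec q (r, M) t s' \<Longrightarrow> exec (IfLess i j p q) (r, M) (1 + t) s'"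
| WhileTrue: "r i < r j \<Longrightarrow> exec p (r, M) t s' \<Longrightarrow> exec (WhileLess i j p) s' t' s'' \<Longrightarrow>
    exec (WhileLess i j p) (r, M) (1 + t + t') s''"
| WhileFalse: "\<not> r i < r j \<Longrightarrow> exec (WhileLess i j p) (r, M) 1 (r, M)"

text \<open>A graph with vertices \<open>0, \<dots>, n - 1\<close> is presented by an arbitrarily ordered and
  arbitrarily oriented list of its edges, each occurring exactly once.\<close>

definition edge_list_of :: "nat bgraph \<Rightarrow> (nat \<times> nat \<times> colour) list \<Rightarrow> bool" where
  "edge_list_of G es \<longleftrightarrow>
     verts G = {..<card (verts G)} \<and>
     distinct (map (\<lambda>(u, v, c). {u, v}) es) \<and>
     blue G = {{u, v} |u v. (u, v, Blue) \<in> set es} \<and>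
     red G = {{u, v} |u v. (u, v, Red) \<in> set es}"

fun edge_code :: "nat \<times> nat \<times> colour \<Rightarrow> int list" where
  "edge_code (u, v, c) = [int u, int v, (case c of Blue \<Rightarrow> 0 | Red \<Rightarrow> 1)]"

text \<open>Initially the registers 0, 1, 2 hold \<open>n\<close>, \<open>m\<close>, \<open>k\<close>, the memory cells
  \<open>0, \<dots>, 3 m - 1\<close> hold the edge list, and everything else is 0.\<close>

definition input_state :: "nat \<Rightarrow> (nat \<times> nat \<times> colour) list \<Rightarrow> int \<Rightarrow> state" where
  "input_state n es k =
     ((\<lambda>_. 0)(0 := int n, 1 := int (length es), 2 := k),
      \<lambda>a. let code = concat (map edge_code es) in if a < length code then code ! a else 0)"

text \<open>The answer is left in register 0.\<close>

definition outputs :: "state \<Rightarrow> bool \<Rightarrow> bool" where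
  "outputs s b \<longleftrightarrow> fst s 0 = (if b then 1 else 0)"

end

theory Submission
  imports Defs
begin

text \<open>In a graph of \<open>\<T>\<close> the blue edges form disjoint cliques and so do the red ones, and every
  red-blue-red path closes to an alternating 4-cycle. Hence a component either consists of two blue
  cliques joined by a red matching of size at least 2, or of one red clique \<open>Q\<close> each of whose
  vertices \<open>v\<close> lies in a private blue clique with \<open>\<beta>(v)\<close> further vertices. The first kind costs one
  deletion per red edge, or nothing if it is a 4-cycle. In the second kind, every red component
  left in \<open>Q\<close> contains at most one vertex that keeps a blue edge. If these vertices form the
  set \<open>A\<close>, the cheapest way is to isolate all but one element of \<open>A\<close> within \<open>Q\<close> and to remove the
  blue edges at \<open>Q - A\<close>, and \<open>A\<close> may be taken to consist of vertices of largest \<open>\<beta>\<close>. So it suffices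
  to try one threshold vertex per candidate \<open>A\<close>.

  The lower bound puts two tokens on every deleted edge and distributes them to the red cliques such
  that each clique receives at least twice its cost.

  All quantities involved are sums over neighbourhoods, so a constant number of passes over the
  edge list, with auxiliary arrays indexed by vertices, computes the optimum in time \<open>O(m + 1)\<close>.\<close>

section \<open>Induced paths and the structure of the class\<close>

definition nbh :: "'a bgraph \<Rightarrow> colour \<Rightarrow> 'a \<Rightarrow> 'a set" where
  "nbh G c v = {w. {v, w} \<in> (case c of Blue \<Rightarrow> blue G | Red \<Rightarrow> red G)}"

text \<open>The non-adjacencies force \<open>a, b, c, d\<close> to be distinct.\<close>

definition induced_P4 :: "'a bgraph \<Rightarrow> colour \<Rightarrow> colour \<Rightarrow> colour \<Rightarrow> 'a \<Rightarrow> 'a \<Rightarrow> 'a \<Rightarrow> 'a \<Rightarrow> bool" where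
  "induced_P4 G x y z a b c d \<longleftrightarrow>
     b \<in> nbh G x a \<and> c \<in> nbh G y b \<and> d \<in> nbh G z c \<and>
     (\<forall>h. c \<notin> nbh G h a \<and> d \<notin> nbh G h b \<and> d \<notin> nbh G h a)"

lemma nbh_commute: "w \<in> nbh G c v \<longleftrightarrow> v \<in> nbh G c w"
  by (simp add: nbh_def insert_commute)

lemma nbh_delete_edges: "nbh (delete_edges G S) c v = {w \<in> nbh G c v. {v, w} \<notin> S}"
  by (auto simp: nbh_def delete_edges_def split: colour.splits)

lemma all_colour: "(\<forall>h. P h) \<longleftrightarrow> P Blue \<and> P Red"
  by (metis colour.exhaust)

lemma bicolored_graph_delete_edges: "bicolored_graph G \<Longrightarrow> bicolored_graph (delete_edges G S)"
  by (auto simp: bicolored_graph_def delete_edges_def edges_def)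

lemma nbh_edges: "w \<in> nbh G c v \<Longrightarrow> {v, w} \<in> edges G"
  by (auto simp: nbh_def edges_def split: colour.splits)

lemma nbh_irrefl: "bicolored_graph G \<Longrightarrow> v \<notin> nbh G c v"
  using nbh_edges[of v G c v] unfolding bicolored_graph_def by force

lemma nbh_verts: "bicolored_graph G \<Longrightarrow> w \<in> nbh G c v \<Longrightarrow> v \<in> verts G \<and> w \<in> verts G"
  using nbh_edges[of w G c v] unfolding bicolored_graph_def by blast

lemma nbh_disjoint: "bicolored_graph G \<Longrightarrow> w \<in> nbh G Blue v \<Longrightarrow> w \<notin> nbh G Red v"
  by (force simp: nbh_def bicolored_graph_def)

lemma contains_induced_nbh:
  "contains_induced G H \<longleftrightarrow>
     (\<exists>f. inj_on f (verts H) \<and> f ` verts H \<subseteq> verts G \<and>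
       (\<forall>x\<in>verts H. \<forall>y\<in>verts H. \<forall>c. f y \<in> nbh G c (f x) \<longleftrightarrow> y \<in> nbh H c x))"
  unfolding contains_induced_def all_colour by (simp add: nbh_def)

lemma verts_path3: "verts (path_graph [x, y, z]) = {0, 1, 2, 3}"
  and verts_path2: "verts (path_graph [x, y]) = {0, 1, 2}"
  by (auto simp: path_graph_def)

lemma nbh_path_graph:
  "j \<in> nbh (path_graph cs) c i \<longleftrightarrow>
     j = Suc i \<and> i < length cs \<and> cs ! i = c \<or> i = Suc j \<and> j < length cs \<and> cs ! j = c"
  by (cases c) (auto simp: nbh_def path_graph_def doubleton_eq_iff)

lemma nbh_triangle_BBR:
  "j \<in> nbh triangle_BBR c i \<longleftrightarrow>
     {i, j} \<in> (case c of Blue \<Rightarrow> {{0, 1}, {1, 2}} | Red \<Rightarrow> {{0, 2}})"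
  and nbh_triangle_RRB:
  "j \<in> nbh triangle_RRB c i \<longleftrightarrow>
     {i, j} \<in> (case c of Red \<Rightarrow> {{0, 1}, {1, 2}} | Blue \<Rightarrow> {{0, 2}})"
  by (cases c; simp add: nbh_def triangle_BBR_def triangle_RRB_def)+

text \<open>Replaces embeddings by four explicit vertices; the converse works because an edge has
  only one colour and the non-adjacencies in \<open>induced_P4\<close> make the map
  injective.\<close>

lemma contains_induced_P4_iff:
  assumes G: "bicolored_graph G"
  shows "contains_induced G (path_graph [x, y, z]) \<longleftrightarrow> (\<exists>a b c d. induced_P4 G x y z a b c d)"
proof
  assume "contains_induced G (path_graph [x, y, z])"
  then obtain f where f: "\<forall>i\<in>{0,1,2,3}. \<forall>j\<in>{0,1,2,3}. \<forall>c. f j \<in> nbh G c (f i) \<longleftrightarrow> j \<in> nbh (path_graph [x,y,z]) c i"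
    unfolding contains_induced_nbh verts_path3 by (elim exE conjE)
  have "induced_P4 G x y z (f 0) (f 1) (f 2) (f 3)"
    using f unfolding induced_P4_def by (simp add: nbh_path_graph)
  then show "\<exists>a b c d. induced_P4 G x y z a b c d" by blast
next
  assume "\<exists>a b c d. induced_P4 G x y z a b c d"
  then obtain a b c d where p: "induced_P4 G x y z a b c d" by blast
  note irr = nbh_irrefl[OF G]
  have uniq: "v \<in> nbh G h w \<Longrightarrow> v \<in> nbh G h' w \<longleftrightarrow> h = h'" for v w h h'
    using nbh_disjoint[OF G] by (cases h; cases h') auto
  \<comment> \<open>Identifying two non-consecutive vertices would produce a forbidden adjacency;
    for instance \<open>a = c\<close> would put \<open>d\<close> next to \<open>a\<close>.\<close>
  have dist: "a \<noteq> b" "a \<noteq> c" "a \<noteq> d" "b \<noteq> c" "b \<noteq> d" "c \<noteq> d"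
    using p irr nbh_commute unfolding induced_P4_def by metis+
  have vs: "{a, b, c, d} \<subseteq> verts G"
    using p nbh_verts[OF G] unfolding induced_P4_def by blast
  have e: "b \<in> nbh G h a \<longleftrightarrow> x = h" "c \<in> nbh G h b \<longleftrightarrow> y = h" "d \<in> nbh G h c \<longleftrightarrow> z = h"
    "a \<in> nbh G h b \<longleftrightarrow> x = h" "b \<in> nbh G h c \<longleftrightarrow> y = h" "c \<in> nbh G h d \<longleftrightarrow> z = h"
    "c \<notin> nbh G h a" "d \<notin> nbh G h b" "d \<notin> nbh G h a"
    "a \<notin> nbh G h c" "b \<notin> nbh G h d" "a \<notin> nbh G h d" for h
    using p uniq nbh_commute unfolding induced_P4_def by metis+
  let ?f = "\<lambda>i::nat. [a, b, c, d] ! i"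
  show "contains_induced G (path_graph [x, y, z])"
    unfolding contains_induced_nbh verts_path3
    by (rule exI[of _ ?f]) (use dist vs in \<open>simp add: nbh_path_graph e irr\<close>)
qed

lemma bicolored_P4_free_iff:
  assumes "bicolored_graph G"
  shows "bicolored_P4_free G \<longleftrightarrow>
    (\<forall>x y z a b c d. induced_P4 G x y z a b c d \<longrightarrow> x = y \<and> y = z)"
proof -
  have *: "length cs = 3 \<longleftrightarrow> (\<exists>x y z. cs = [x, y, z])" for cs :: "colour list"
    by (auto simp: length_Suc_conv numeral_3_eq_3)
  have **: "Blue \<in> {x,y,z} \<and> Red \<in> {x,y,z} \<longleftrightarrow> \<not> (x = y \<and> y = z)" for x y z
    by (cases x; cases y; cases z) auto
  have "bicolored_P4_free G \<longleftrightarrow> (\<forall>x y z. Blue \<in> {x,y,z} \<and> Red \<in> {x,y,z} \<longrightarrow> \<not> contains_induced G (path_graph [x, y, z]))"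
    unfolding bicolored_P4_free_def * by fastforce
  then show ?thesis unfolding ** contains_induced_P4_iff[OF assms] by blast
qed

section \<open>Local structure of graphs in the class\<close>

locale class_T_graph =
  fixes G :: "'a::linorder bgraph"
  assumes in_class_T: "G \<in> class_T"
begin

abbreviation "B \<equiv> nbh G Blue"
abbreviation "R \<equiv> nbh G Red"

lemma bicolored: "bicolored_graph G"
  using in_class_T by (simp add: class_T_def)

lemma finite_verts: "finite (verts G)"
  using bicolored by (simp add: bicolored_graph_def)

lemma finite_nbh[simp]: "finite (nbh G c v)"
  by (rule finite_subset[OF _ finite_verts]) (use nbh_verts[OF bicolored] in auto)

lemmas irrefl[simp] = nbh_irrefl[OF bicolored]
lemmas in_verts = nbh_verts[OF bicolored]
lemmas disjoint = nbh_disjoint[OF bicolored]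

lemma nbh_unique: "v \<in> nbh G h w \<Longrightarrow> v \<in> nbh G h' w \<Longrightarrow> h = h'"
  using disjoint by (cases h; cases h') auto

text \<open>If \<open>x\<close> and \<open>z\<close> were not adjacent, the three vertices would
  induce a monochromatic path; if their edge had the other colour, a forbidden triangle. So each
  colour class is a disjoint union of cliques.\<close>

lemma mono_transitive:
  assumes xy: "y \<in> nbh G h x" and yz: "z \<in> nbh G h y" and "x \<noteq> z"
  shows "z \<in> nbh G h x"
proof (rule ccontr)
  assume n: "z \<notin> nbh G h x"
  have xy': "x \<in> nbh G h y" and yz': "y \<in> nbh G h z"
    using xy yz nbh_commute by metis+
  have d: "x \<noteq> y" "y \<noteq> z" using xy yz irrefl by metis+
  have vs: "x \<in> verts G" "y \<in> verts G" "z \<in> verts G" using xy yz in_verts by blast+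
  have e: "y \<in> nbh G h' x \<longleftrightarrow> h = h'" "z \<in> nbh G h' y \<longleftrightarrow> h = h'" 
     "x \<in> nbh G h' y \<longleftrightarrow> h = h'" "y \<in> nbh G h' z \<longleftrightarrow> h = h'" for h'
    using xy yz xy' yz' nbh_unique by metis+
  let ?f = "\<lambda>i::nat. [x, y, z] ! i"
  show False
  proof (cases "\<exists>h'. z \<in> nbh G h' x")
    case False
    then have e': "z \<notin> nbh G h' x" "x \<notin> nbh G h' z" for h'
      using nbh_commute by metis+
    have "contains_induced G (path_graph [h, h])"
      unfolding contains_induced_nbh verts_path2
      by (rule exI[of _ ?f]) (use d vs \<open>x \<noteq> z\<close> in \<open>simp add: nbh_path_graph e e'\<close>)
    then show False using in_class_T unfolding class_T_def by (cases h) auto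
  next
    case True
    then have e': "z \<in> nbh G h' x \<longleftrightarrow> h' \<noteq> h" "x \<in> nbh G h' z \<longleftrightarrow> h' \<noteq> h" for h'
      using n nbh_commute[of x G h' z] nbh_unique by (metis (full_types) colour.exhaust)+
    have "contains_induced G (case h of Blue \<Rightarrow> triangle_BBR | Red \<Rightarrow> triangle_RRB)"
      unfolding contains_induced_nbh
      by (rule exI[of _ ?f], cases h) (use d vs \<open>x \<noteq> z\<close> in \<open>simp_all add: all_colour nbh_triangle_BBR nbh_triangle_RRB e e' doubleton_eq_iff triangle_BBR_def[THEN arg_cong[of _ _ verts]] triangle_RRB_def[THEN arg_cong[of _ _ verts]]\<close>)
    then show False using in_class_T unfolding class_T_def by (cases h) auto
  qed
qed

text \<open>The closing edge would share its colour with one of the two given edges, and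
  \<open>mono_transitive\<close> would force the remaining edge into that colour as well.\<close>

lemma no_bichromatic_triangle:
  assumes xy: "y \<in> nbh G h x" and yz: "z \<in> nbh G h' y" and "h \<noteq> h'"
  shows "z \<notin> nbh G k x"
proof
  assume xz: "z \<in> nbh G k x"
  have d: "x \<noteq> y" "y \<noteq> z" "x \<noteq> z" using xy yz xz irrefl by blast+
  note c = nbh_commute[THEN iffD1]
  consider "k = h" | "k = h'" using \<open>h \<noteq> h'\<close> by (cases h; cases h'; cases k) auto
  then show False
  proof cases
    case 1
    then have "z \<in> nbh G h y" using mono_transitive[OF c[OF xy]] xz d by blast
    then show False using nbh_unique[OF yz] \<open>h \<noteq> h'\<close> by blast
  next
    case 2
    then have "y \<in> nbh G h' x" using mono_transitive[OF xz, of y] c[OF yz] d by blast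
    then show False using nbh_unique[OF xy] \<open>h \<noteq> h'\<close> by blast
  qed
qed

text \<open>Both chords close a bichromatic triangle, so only an edge between \<open>a\<close> and
  \<open>d\<close> keeps this red-blue-red path from being induced. Were it red, \<open>x\<close>
  and \<open>d\<close> would be adjacent.\<close>

lemma alternating_square:
  assumes ax: "x \<in> R a" and xy: "y \<in> B x" and yd: "d \<in> R y"
  shows "d \<in> B a"
proof -
  have 1: "y \<notin> nbh G h a" for h
    using no_bichromatic_triangle[OF ax xy] by simp
  have 2: "d \<notin> nbh G h x" for h
    using no_bichromatic_triangle[OF xy yd] by simp
  have 3: "\<not> induced_P4 G Red Blue Red a x y d"
    using in_class_T contains_induced_P4_iff[OF bicolored] unfolding class_T_def by blast
  have 4: "d \<notin> R a"
  proof
    assume "d \<in> R a"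
    moreover have "x \<noteq> d"
      using disjoint[OF xy] nbh_commute[of d G Red y] yd by blast
    ultimately show False
      using mono_transitive[OF nbh_commute[THEN iffD1, OF ax]] 2 by blast
  qed
  show ?thesis
    using 1 2 3 4 ax xy yd unfolding induced_P4_def all_colour by blast
qed

end

section \<open>Lexicographic ranking and the lower bound\<close>

text \<open>Breaking ties by the order on the vertices gives a strict total order even if
  \<open>f\<close> is not injective, so ranks and minima are unique.\<close>

definition lex_less :: "('a::linorder \<Rightarrow> 'b::linorder) \<Rightarrow> 'a \<Rightarrow> 'a \<Rightarrow> bool" where
  "lex_less f u v \<longleftrightarrow> f u < f v \<or> f u = f v \<and> u < v"

lemma lex_less_irrefl[simp]: "\<not> lex_less f u u"
  by (simp add: lex_less_def)

lemma lex_less_trans: "lex_less f u v \<Longrightarrow> lex_less f v w \<Longrightarrow> lex_less f u w"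
  by (auto simp: lex_less_def)

lemma not_lex_less: "\<not> lex_less f u v \<longleftrightarrow> u = v \<or> lex_less f v u"
  by (auto simp: lex_less_def)

lemma lex_less_asym: "lex_less f u v \<Longrightarrow> \<not> lex_less f v u"
  by (auto simp: lex_less_def)

lemma lex_less_le: "lex_less f u v \<Longrightarrow> f u \<le> f v"
  by (auto simp: lex_less_def)

lemma card_above_less:
  assumes "finite X" "w \<in> X" "lex_less f v w"
  shows "card {u\<in>X. lex_less f w u} < card {u\<in>X. lex_less f v u}"
proof (rule psubset_card_mono)
  show "{u\<in>X. lex_less f w u} \<subset> {u\<in>X. lex_less f v u}"
    using assms lex_less_trans[OF assms(3)] lex_less_irrefl by blast
qed (use assms in simp)

lemma inj_on_card_above:
  assumes "finite X"
  shows "inj_on (\<lambda>v. card {u\<in>X. lex_less f v u}) X"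
proof (rule inj_onI, rule ccontr)
  fix v w assume *: "v \<in> X" "w \<in> X" "card {u\<in>X. lex_less f v u} = card {u\<in>X. lex_less f w u}" "v \<noteq> w"
  then consider "lex_less f v w" | "lex_less f w v" using not_lex_less by blast
  then show False
    using card_above_less[OF assms, of _ f] * by cases fastforce+
qed

text \<open>The rank map is injective into a set of the same finite size, hence onto.\<close>

lemma ex_card_above:
  assumes X: "finite X" and j: "j < card X"
  shows "\<exists>v\<in>X. card {u\<in>X. lex_less f v u} = j"
proof -
  let ?h = "\<lambda>v. card {u\<in>X. lex_less f v u}"
  have "?h ` X \<subseteq> {..<card X}"
  proof clarify
    fix v assume "v \<in> X"
    then have "{u\<in>X. lex_less f v u} \<subset> X" using lex_less_irrefl by blast
    then show "?h v < card X" using X by (rule psubset_card_mono[rotated])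
  qed
  moreover have "card (?h ` X) = card {..<card X}"
    using card_image[OF inj_on_card_above[OF X]] by simp
  ultimately have "?h ` X = {..<card X}"
    by (intro card_subset_eq) auto
  then show ?thesis using j by (metis (mono_tags, lifting) imageE lessThan_iff)
qed

lemma card_below:
  assumes X: "finite X" and u: "u \<in> X"
  shows "card {w\<in>X. lex_less f w u} = card X - 1 - card {w\<in>X. lex_less f u w}"
proof -
  have "X - {u} = {w\<in>X. lex_less f w u} \<union> {w\<in>X. lex_less f u w}"
    using u not_lex_less[of f] by fastforce
  moreover have "{w\<in>X. lex_less f w u} \<inter> {w\<in>X. lex_less f u w} = {}"
    by (auto simp: lex_less_def)
  ultimately have "card X - 1 = card {w\<in>X. lex_less f w u} + card {w\<in>X. lex_less f u w}"
    using X u by (metis (no_types, lifting) card_Diff_singleton card_Un_disjoint finite_Diff finite_Un)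
  then show ?thesis by simp
qed

text \<open>The elements above \<open>v\<close> have the ranks 0 to \<open>j - 1\<close>, and the
  one of rank \<open>i\<close> has \<open>card X - 1 - i\<close> elements below it. The sum is the
  number of edges of a complete graph on \<open>X\<close> that meet \<open>j\<close> given
  vertices.\<close>

lemma sum_card_below:
  assumes X: "finite X" and j: "card {u\<in>X. lex_less f v u} = j"
  shows "(\<Sum>u | u \<in> X \<and> lex_less f v u. card {w\<in>X. lex_less f w u}) = (\<Sum>i<j. card X - 1 - i)"
proof -
  let ?h = "\<lambda>v. card {u\<in>X. lex_less f v u}" and ?U = "{u\<in>X. lex_less f v u}"
  have inj: "inj_on ?h ?U"
    using inj_on_card_above[OF X] by (rule inj_on_subset) auto
  have "?h ` ?U \<subseteq> {..<j}"
    using card_above_less[OF X] j by blast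
  moreover have "card (?h ` ?U) = card {..<j}"
    using card_image[OF inj] j by simp
  ultimately have im: "?h ` ?U = {..<j}"
    by (intro card_subset_eq) auto
  have "(\<Sum>i<j. card X - 1 - i) = (\<Sum>i\<in>?h ` ?U. card X - 1 - i)" unfolding im ..
  also have "\<dots> = (\<Sum>u\<in>?U. card X - 1 - ?h u)"
    using inj by (simp add: sum.reindex)
  also have "\<dots> = (\<Sum>u\<in>?U. card {w\<in>X. lex_less f w u})"
    by (rule sum.cong) (use card_below[OF X, of _ f] in auto)
  finally show ?thesis by simp
qed

text \<open>The top \<open>|A|\<close> elements carry at least as much weight as \<open>A\<close>, so the worst of them is the threshold.\<close>

lemma ex_lex_threshold:
  assumes X: "finite X" and A: "A \<subseteq> X" "A \<noteq> {}"
  shows "\<exists>v\<in>X. (\<Sum>u | u \<in> X \<and> lex_less f v u. card {w\<in>X. lex_less f w u})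
      + (\<Sum>u | u \<in> X \<and> lex_less f u v. f u)
    \<le> (\<Sum>i<card A - 1. card X - 1 - i) + (\<Sum>u\<in>X - A. f u)"
proof -
  have fA: "finite A" using A X finite_subset by blast
  have "0 < card A" using A fA by (simp add: card_gt_0_iff)
  moreover have "card A \<le> card X" using A X by (simp add: card_mono)
  ultimately have "card A - 1 < card X" by linarith
  then obtain v where v: "v \<in> X" "card {u\<in>X. lex_less f v u} = card A - 1"
    using ex_card_above[OF X, of "card A - 1" f] by blast
  let ?T = "insert v {u\<in>X. lex_less f v u}"
  have T: "{u\<in>X. lex_less f u v} = X - ?T" "?T \<subseteq> X"
    using v(1) by (auto simp: not_lex_less dest: lex_less_asym)
  have "card ?T = card A" using v \<open>0 < card A\<close> X by simp
  \<comment> \<open>Exchange argument: both differences have the same size, and \<open>f v\<close>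
    separates the weights in one from those in the other.\<close>
  then have c: "card (?T - A) = card (A - ?T)"
    using X fA card_Int_Diff[of ?T A] card_Int_Diff[of A ?T] by (simp add: Int_commute)
  have le: "f u \<le> f v" if "u \<in> A - ?T" for u
    using that A not_lex_less[of f v u] lex_less_le[of f u v] by blast
  have ge: "f v \<le> f u" if "u \<in> ?T - A" for u
    using that lex_less_le[of f v u] by auto
  have "(\<Sum>u\<in>X - ?T. f u) = (\<Sum>u\<in>X - (?T \<union> A). f u) + (\<Sum>u\<in>A - ?T. f u)"
    using X A fA by (subst sum.union_disjoint[symmetric]) (auto intro: sum.cong)
  also have "(\<Sum>u\<in>A - ?T. f u) \<le> card (A - ?T) * f v"
    using sum_bounded_above[of "A - ?T" f "f v", OF le] by simp
  also have "\<dots> = card (?T - A) * f v" using c by simp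
  also have "\<dots> \<le> (\<Sum>u\<in>?T - A. f u)"
    using sum_bounded_below[of "?T - A" "f v" f, OF ge] by simp
  also have "(\<Sum>u\<in>X - (?T \<union> A). f u) + (\<Sum>u\<in>?T - A. f u) = (\<Sum>u\<in>X - A. f u)"
    using X T by (subst sum.union_disjoint[symmetric]) (auto intro: sum.cong)
  finally have "(\<Sum>u\<in>X - ?T. f u) \<le> (\<Sum>u\<in>X - A. f u)"
    by simp
  then have "(\<Sum>u | u \<in> X \<and> lex_less f u v. f u) \<le> (\<Sum>u\<in>X - A. f u)"
    unfolding T(1) .
  then show ?thesis
    using v(1) sum_card_below[OF X v(2)] by (intro bexI[of _ v]) auto
qed

section \<open>Costs of red cliques\<close>

context class_T_graph
begin

definition bdeg :: "'a \<Rightarrow> nat" where "bdeg v = card (B v)"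

text \<open>For a vertex on a red edge this separates the two kinds of components: it is positive
  where two blue cliques are joined by a red matching, and 0 where the blue cliques are
  private.\<close>

definition links :: "'a \<Rightarrow> nat" where "links v = card {w \<in> B v. R w \<noteq> {}}"

text \<open>Counting red edges at their larger end only makes each of them count once.\<close>

definition below :: "'a \<Rightarrow> nat" where "below v = card {w \<in> R v. lex_less bdeg w v}"

text \<open>If \<open>links v = 0\<close>, then \<open>cost v\<close> is the price of the deletion that isolates
  every \<open>u \<succ> v\<close> of the red clique within that clique and strips every \<open>u \<prec> v\<close> of its blue edges.
  The first case of the sum describes a component that is an alternating 4-cycle.\<close>

definition cost :: "'a \<Rightarrow> nat" where
  "cost v = (\<Sum>w\<in>R v. if 0 < links v \<and> bdeg v + bdeg w < 3 then 0
     else if lex_less bdeg v w then below w else bdeg w)"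

text \<open>Exactly one vertex per red clique, attaining the minimal cost.\<close>

definition winners :: "'a set" where
  "winners = {v \<in> verts G. {w \<in> R v. lex_less cost w v} = {}}"

definition red_clique :: "'a \<Rightarrow> 'a set" where "red_clique v = insert v (R v)"

lemma links_pos_iff: "0 < links v \<longleftrightarrow> (\<exists>w\<in>B v. R w \<noteq> {})"
  by (auto simp: links_def card_gt_0_iff)

lemma red_clique_refl[simp]: "v \<in> red_clique v"
  by (simp add: red_clique_def)

lemma red_clique_eq:
  assumes "x \<in> red_clique v"
  shows "red_clique x = red_clique v"
proof -
  have *: "red_clique x \<subseteq> red_clique v" if "x \<in> red_clique v" for x v
    using that mono_transitive[of x Red v] unfolding red_clique_def by blast
  have "v \<in> red_clique x" using assms nbh_commute[of x G Red v] unfolding red_clique_def by blast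
  then show ?thesis using *[of x v] *[of v x] assms by blast
qed

lemma red_nbh_eq: "x \<in> red_clique v \<Longrightarrow> R x = red_clique v - {x}"
  using red_clique_eq[of x v] unfolding red_clique_def using irrefl by blast

lemma finite_red_clique[simp]: "finite (red_clique v)"
  by (simp add: red_clique_def)

text \<open>A blue neighbour \<open>x\<close> of \<open>v\<close> with a red neighbour
  \<open>y\<close> closes an alternating square through every red neighbour of \<open>v\<close>. All
  of them are thus blue neighbours of \<open>y\<close>, so two of them would be adjacent in both
  colours.\<close>

lemma linked_red_edge:
  assumes w: "w \<in> R v" and l: "0 < links v"
  shows "R v = {w} \<and> R w = {v} \<and> 0 < links w"
proof -
  note c = nbh_commute[THEN iffD1]
  have one: "R v = {w} \<and> 0 < links w" if w: "w \<in> R v" and l: "0 < links v" for v w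
  proof -
    obtain x y where xy: "x \<in> B v" "y \<in> R x" using l links_pos_iff by auto
    have y: "y \<in> B w'" if "w' \<in> R v" for w'
      using alternating_square[OF c[OF that] xy] .
    have "w' = w" if w': "w' \<in> R v" for w'
    proof (rule ccontr)
      assume "w' \<noteq> w"
      then have "w' \<in> R w" "w' \<in> B w"
        using mono_transitive[OF c[OF w] w'] mono_transitive[OF y[OF w] c[OF y[OF w']]] by auto
      then show False using disjoint by blast
    qed
    then show ?thesis using w y[OF w] c[OF xy(2)] links_pos_iff by blast
  qed
  show ?thesis using one[OF w l] one[OF c[OF w]] by blast
qed

text \<open>Brings the cost into the form minimised in \<open>ex_lex_threshold\<close>, with the
  whole red clique as the ground set.\<close>

lemma cost_unlinked:
  assumes x: "x \<in> red_clique v" and l: "links x = 0"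
  shows "cost x = (\<Sum>u | u \<in> red_clique v \<and> lex_less bdeg x u. card {w \<in> red_clique v. lex_less bdeg w u})
      + (\<Sum>u | u \<in> red_clique v \<and> lex_less bdeg u x. bdeg u)"
proof -
  let ?Q = "red_clique v"
  have b: "below u = card {w \<in> ?Q. lex_less bdeg w u}" if "u \<in> ?Q" for u
    unfolding below_def red_nbh_eq[OF that] by (rule arg_cong[of _ _ card]) auto
  have "cost x = (\<Sum>w\<in>R x. if lex_less bdeg x w then below w else bdeg w)"
    using l by (simp add: cost_def)
  also have "\<dots> = (\<Sum>w\<in>R x \<inter> {w. lex_less bdeg x w}. below w) + (\<Sum>w\<in>R x \<inter> - {w. lex_less bdeg x w}. bdeg w)"
    by (rule sum.If_cases) simp
  also have "R x \<inter> {w. lex_less bdeg x w} = {u. u \<in> ?Q \<and> lex_less bdeg x u}"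
    unfolding red_nbh_eq[OF x] by auto
  also have "R x \<inter> - {w. lex_less bdeg x w} = {u. u \<in> ?Q \<and> lex_less bdeg u x}"
    unfolding red_nbh_eq[OF x] by (auto simp: not_lex_less dest: lex_less_asym)
  finally show ?thesis using b by simp
qed

end

section \<open>Charging the edges of an arbitrary solution\<close>

locale P4_deletion = class_T_graph G for G :: "'a::linorder bgraph" +
  fixes S :: "'a set set"
  assumes S_edges: "S \<subseteq> edges G" and S_free: "bicolored_P4_free (delete_edges G S)"
begin

abbreviation "N' \<equiv> nbh (delete_edges G S)"

lemma N'_iff: "w \<in> N' c v \<longleftrightarrow> w \<in> nbh G c v \<and> {v, w} \<notin> S"
  by (simp add: nbh_delete_edges)

lemma no_P4:
  assumes "b \<in> N' x a" "c \<in> N' y b" "d \<in> N' z c"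
    and "\<And>h. c \<notin> N' h a" "\<And>h. d \<notin> N' h b" "\<And>h. d \<notin> N' h a"
  shows "x = y \<and> y = z"
proof -
  have "induced_P4 (delete_edges G S) x y z a b c d"
    using assms by (simp add: induced_P4_def)
  then show ?thesis
    using S_free bicolored_P4_free_iff[OF bicolored_graph_delete_edges[OF bicolored]] by blast
qed

definition active :: "'a \<Rightarrow> bool" where "active x \<longleftrightarrow> N' Blue x \<noteq> {}"

definition kept :: "'a \<Rightarrow> bool" where "kept x \<longleftrightarrow> N' Red x \<noteq> {}"

text \<open>The part of the two tokens on a deleted edge \<open>{x, w}\<close> that goes to the red clique of \<open>x\<close>.
  Blue tokens go to the endpoint that keeps a red edge, as that one has to pay for it.\<close>

definition share :: "'a \<Rightarrow> 'a \<Rightarrow> nat" where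
  "share x w =
     (if w \<in> R x then if active x = active w then 1 else if active x then 0 else 2
      else if R x = {} then 0 else if R w = {} then 2
      else if kept x = kept w then 1 else if kept x then 2 else 0)"

definition charge :: "'a \<Rightarrow> nat" where "charge x = (\<Sum>w | {x, w} \<in> S. share x w)"

lemma share_add: "share x w + share w x \<le> 2"
  using nbh_commute[of x G Red w] by (auto simp: share_def)

lemma del_verts: "{x, w} \<in> S \<Longrightarrow> x \<in> verts G \<and> w \<in> verts G "
  using S_edges bicolored unfolding bicolored_graph_def by blast

lemma finite_del[simp]: "finite {w. {x, w} \<in> S}"
  by (rule finite_subset[OF _ finite_verts]) (use del_verts in auto)

lemma finite_S: "finite S"
proof (rule finite_subset)
  show "S \<subseteq> Pow (verts G)" using S_edges bicolored unfolding bicolored_graph_def by blast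
qed (simp add: finite_verts)

text \<open>Double counting: an edge arises from at most two ordered pairs, and by
  \<open>share_add\<close> it hands out at most two tokens in total.\<close>

lemma sum_charge: "(\<Sum>x\<in>verts G. charge x) \<le> 2 * card S"
proof -
  let ?P = "SIGMA x:verts G. {w. {x, w} \<in> S}" and ?e = "\<lambda>(x, w). {x, w}" and ?g = "\<lambda>(x, w). share x w"
  have fP: "finite ?P" using finite_verts by simp
  have "(\<Sum>x\<in>verts G. charge x) = sum ?g ?P"
    unfolding charge_def by (rule sum.Sigma) (use finite_verts in auto)
  also have "\<dots> = (\<Sum>e\<in>S. sum ?g {p \<in> ?P. ?e p = e})"
    by (rule sum.group[symmetric]) (use fP finite_S in auto)
  also have "\<dots> \<le> (\<Sum>e\<in>S. 2)"
  proof (rule sum_mono)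
    fix e assume e: "e \<in> S"
    then have "card e = 2" using S_edges bicolored unfolding bicolored_graph_def by blast
    then obtain a b where ab: "e = {a, b}" "a \<noteq> b" by (auto simp: card_2_iff)
    have "{p \<in> ?P. ?e p = e} \<subseteq> {(a, b), (b, a)}"
      using ab by (auto simp: doubleton_eq_iff)
    then have "sum ?g {p \<in> ?P. ?e p = e} \<le> sum ?g {(a, b), (b, a)}"
      by (intro sum_mono2) auto
    then show "sum ?g {p \<in> ?P. ?e p = e} \<le> 2"
      using ab(2) share_add[of a b] by simp
  qed
  finally show ?thesis by simp
qed

lemma share_le_charge: "{x, w} \<in> S \<Longrightarrow> share x w \<le> charge x"
  unfolding charge_def by (rule member_le_sum) auto

text \<open>With fewer than two tokens, \<open>x\<close> must keep a red edge to some
  \<open>y\<close>, and the blue edge from \<open>w\<close> to \<open>y\<close> must survive. Then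
  \<open>v\<close>, \<open>w\<close>, \<open>y\<close>, \<open>x\<close> form an induced
  red-blue-red path, the blue edge that closed the square being deleted.\<close>

lemma charge_blue_deleted:
  assumes w: "w \<in> R v" and l: "0 < links v" and k: "{v, w} \<notin> S" and x: "x \<in> B v" "{v, x} \<in> S"
  shows "2 \<le> charge v + charge w"
proof (rule ccontr)
  assume n: "\<not> 2 \<le> charge v + charge w"
  note c = nbh_commute[THEN iffD1]
  have kv: "kept v" "kept w" using w k c[OF w] N'_iff unfolding kept_def by (auto simp: insert_commute)
  have xR: "x \<notin> R v" using disjoint x by blast
  \<comment> \<open>If \<open>x\<close> kept no red edge, both tokens of the blue edge would go to
    \<open>v\<close>.\<close>
  have "share v x \<le> 1" using n share_le_charge[OF x(2)] by simp
  then have "R x \<noteq> {}" "kept x" using xR w kv by (auto simp: share_def split: if_splits)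
  then obtain y where y: "y \<in> R x" "{x, y} \<notin> S" unfolding kept_def nbh_delete_edges by auto
  have yw: "y \<in> B w" using alternating_square[OF c[OF w] x(1) y(1)] .
  have "1 \<le> share v x" using xR w kv by (auto simp: share_def)
  then have "charge w = 0" using n share_le_charge[OF x(2)] by simp
  moreover have "1 \<le> share w y" using disjoint[OF yw] c[OF w] kv by (auto simp: share_def)
  ultimately have wy: "{w, y} \<notin> S" using share_le_charge[of w y] by force
  have "w \<in> N' Red v" "y \<in> N' Blue w" "x \<in> N' Red y"
    using w k yw wy y c[OF y(1)] by (simp_all add: N'_iff insert_commute)
  moreover have "y \<notin> N' h v" "x \<notin> N' h w" "x \<notin> N' h v" for h
    using no_bichromatic_triangle[OF w yw] no_bichromatic_triangle[OF c[OF w] x(1)] x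
    by (simp_all add: N'_iff)
  ultimately show False using no_P4[of w Red v y Blue x Red] by blast
qed

text \<open>A deleted red edge gives both its tokens to its two ends. If it survives,
  \<open>charge_blue_deleted\<close> keeps all blue edges at its ends, and the larger blue clique
  supplies a vertex not adjacent to the opposite one, which yields a blue-red-blue path.\<close>

lemma charge_linked:
  assumes w: "w \<in> R v" and l: "0 < links v" and d: "3 \<le> bdeg v + bdeg w"
  shows "2 \<le> charge v + charge w"
proof (cases "{v, w} \<in> S")
  case True
  have "share v w + share w v = 2" 
    using w nbh_commute[of v G Red w] by (auto simp: share_def)
  then show ?thesis using True share_le_charge[of v w] share_le_charge[of w v] by (simp add: insert_commute)
next
  case False
  note c = nbh_commute[THEN iffD1]
  have lw: "0 < links w" using linked_red_edge[OF w l] by blast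
  \<comment> \<open>Two blue neighbours of \<open>w\<close> are joined by a blue edge, so they
    cannot both be red neighbours of \<open>x\<close>.\<close>
  have ex: "\<exists>x\<in>B v. \<exists>y\<in>B w. y \<notin> R x" if "2 \<le> bdeg w" "0 < links v" for v w
  proof -
    have "B v \<noteq> {}" using that(2) links_pos_iff[of v] by auto
    then obtain x where x: "x \<in> B v" by blast
    have "\<not> (\<forall>y\<in>B w. \<forall>z\<in>B w. y = z)"
      using that(1) card_le_Suc0_iff_eq[of "B w"] unfolding bdeg_def by simp
    then obtain y z where yz: "y \<in> B w" "z \<in> B w" "y \<noteq> z" by blast
    have "z \<in> B y" using mono_transitive[OF c[OF yz(1)] yz(2,3)] .
    then have "\<not> (y \<in> R x \<and> z \<in> R x)"
      using mono_transitive[OF c, of y Red x z] yz(3) disjoint[of z y] by blast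
    then show ?thesis using x yz by blast
  qed
  have "2 \<le> bdeg w \<or> 2 \<le> bdeg v" using d by linarith
  then obtain x y where xy: "x \<in> B v" "y \<in> B w" "y \<notin> R x"
    using ex[of w v] ex[of v w] l lw nbh_commute[of _ G Red] by meson
  have nB: "y \<notin> B x"
  proof
    assume "y \<in> B x"
    moreover have "v \<noteq> y" using disjoint[OF c[OF xy(2)]] w c[of w G Red v] by blast
    ultimately show False
      using mono_transitive[OF xy(1)] no_bichromatic_triangle[OF w xy(2)] by blast
  qed
  show ?thesis
  proof (rule ccontr)
    assume n: "\<not> ?thesis"
    have "{v, x} \<notin> S" "{w, y} \<notin> S"
      using charge_blue_deleted[OF w l False xy(1)] charge_blue_deleted[OF c[OF w] lw _ xy(2)] False n
      by (auto simp: insert_commute)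
    then have "v \<in> N' Blue x" "w \<in> N' Red v" "y \<in> N' Blue w"
      using w False xy c[OF xy(1)] by (simp_all add: N'_iff insert_commute)
    moreover have "w \<notin> N' h x" "y \<notin> N' h v" "y \<notin> N' h x" for h
      using no_bichromatic_triangle[OF c[OF xy(1)] w] no_bichromatic_triangle[OF w xy(2)] nB xy(3)
      by (simp_all add: N'_iff) (cases h; simp)
    ultimately show False using no_P4[of v Blue x w Red y Blue] by blast
  qed
qed

text \<open>Let \<open>A\<close> consist of the clique members that keep a blue edge. No two of them
  stay adjacent or keep a common red neighbour, so the tokens on the deleted red edges, together
  with those on the blue edges at the other members, pay for the threshold deletion that
  \<open>ex_lex_threshold\<close> finds for \<open>A\<close>.\<close>

lemma charge_unlinked:
  assumes ne: "R v \<noteq> {}" and l: "\<And>x. x \<in> red_clique v \<Longrightarrow> links x = 0"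
  shows "\<exists>x\<in>red_clique v. 2 * cost x \<le> sum charge (red_clique v)"
proof -
  note c = nbh_commute[THEN iffD1]
  let ?Q = "red_clique v"
  define A where "A = {x \<in> ?Q. active x}"
  have red: "y \<in> R x" if "x \<in> ?Q" "y \<in> ?Q" "x \<noteq> y" for x y
    using red_nbh_eq[OF that(1)] that by blast
  have RQ: "R x \<noteq> {}" if "x \<in> ?Q" for x
    using ne red[OF that] that unfolding red_clique_def by auto
  have blue_end: "R w = {}" if "x \<in> ?Q" "w \<in> B x" for x w
    using l[OF that(1)] links_pos_iff[of x] that(2) by auto
  \<comment> \<open>A surviving edge between \<open>x\<close> and \<open>y\<close> would be the
    middle of a blue-red-blue path; it is induced since the blue neighbours \<open>x'\<close> and
    \<open>y'\<close> lie in different private cliques.\<close>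
  have AA: "{x, y} \<in> S" if "x \<in> A" "y \<in> A" "x \<noteq> y" for x y
  proof (rule ccontr)
    assume n: "{x, y} \<notin> S"
    have q: "x \<in> ?Q" "y \<in> ?Q" using that A_def by auto
    have "N' Blue x \<noteq> {}" "N' Blue y \<noteq> {}" using that unfolding A_def active_def by auto
    then obtain x' y' where x': "x' \<in> B x" "{x, x'} \<notin> S" and y': "y' \<in> B y" "{y, y'} \<notin> S"
      using N'_iff by blast
    have xy: "y \<in> R x" using red q that by blast
    have 1: "y' \<notin> nbh G h x" "y \<notin> nbh G h x'" for h
      using no_bichromatic_triangle[OF xy y'(1)] no_bichromatic_triangle[OF c[OF x'(1)] xy] by auto
    have "x \<noteq> y'" using c[OF y'(1)] xy disjoint by auto
    then have 2: "y' \<notin> nbh G h x'" for h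
      using blue_end[OF q(1) x'(1)] mono_transitive[OF x'(1), of y'] 1(1)[of Blue]
      by (cases h) auto
    have "x \<in> N' Blue x'" "y \<in> N' Red x" "y' \<in> N' Blue y"
      using xy n x' y' c[OF x'(1)] by (simp_all add: N'_iff insert_commute)
    moreover have "y \<notin> N' h x'" "y' \<notin> N' h x" "y' \<notin> N' h x'" for h
      using 1 2 by (simp_all add: N'_iff)
    ultimately show False using no_P4[of x Blue x' y Red y' Blue] by blast
  qed
  \<comment> \<open>Otherwise \<open>x'\<close>, \<open>x\<close>, \<open>w\<close>,
    \<open>y\<close> form a blue-red-red path, whose chord between \<open>x\<close> and
    \<open>y\<close> is deleted by \<open>AA\<close>.\<close>
  have At: "{w, x} \<in> S \<or> {w, y} \<in> S" if "w \<in> ?Q" "x \<in> A" "y \<in> A" "x \<noteq> y" "w \<noteq> x" "w \<noteq> y" for w x y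
  proof (rule ccontr)
    assume n: "\<not> ({w, x} \<in> S \<or> {w, y} \<in> S)"
    have q: "x \<in> ?Q" "y \<in> ?Q" using that A_def by auto
    have "N' Blue x \<noteq> {}" using that unfolding A_def active_def by auto
    then obtain x' where x': "x' \<in> B x" "{x, x'} \<notin> S" using N'_iff by blast
    have r: "w \<in> R x" "y \<in> R w" "y \<in> R x" using red that q by auto
    have "x \<in> N' Blue x'" "w \<in> N' Red x" "y \<in> N' Red w"
      using n r x' c[OF x'(1)] by (simp_all add: N'_iff insert_commute)
    moreover have "w \<notin> N' h x'" "y \<notin> N' h x" "y \<notin> N' h x'" for h
      using no_bichromatic_triangle[OF c[OF x'(1)] r(1)] no_bichromatic_triangle[OF c[OF x'(1)] r(3)]
        AA[OF that(2,3,4)] by (simp_all add: N'_iff)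
    ultimately show False using no_P4[of x Blue x' w Red y Red] by blast
  qed
  \<comment> \<open>For empty \<open>A\<close> truncated subtraction gives 0, so that only the blue
    deletions count.\<close>
  define j where "j = card A - 1"
  have AQ: "A \<subseteq> ?Q" unfolding A_def by blast
  have fA: "finite A" using finite_subset[OF AQ] by simp
  \<comment> \<open>The outer end of a blue edge at this clique has no red edge, so both tokens of a
    deleted one come to \<open>x\<close>.\<close>
  have split: "charge x \<ge> (\<Sum>w\<in>A'. share x w) + 2 * card {w \<in> B x. {x, w} \<in> S}"
    if x: "x \<in> ?Q" and A': "A' \<subseteq> {w \<in> R x. {x, w} \<in> S}" for x A'
  proof -
    let ?b = "{w \<in> B x. {x, w} \<in> S}"
    have "(\<Sum>w\<in>?b. share x w) = (\<Sum>w\<in>?b. 2)"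
      by (rule sum.cong) (use blue_end[OF x] RQ[OF x] disjoint in \<open>auto simp: share_def\<close>)
    then have "(\<Sum>w\<in>A'. share x w) + 2 * card ?b = (\<Sum>w\<in>A'. share x w) + (\<Sum>w\<in>?b. share x w)" by simp
    also have "\<dots> = (\<Sum>w\<in>A' \<union> ?b. share x w)"
      by (rule sum.union_disjoint[symmetric]) (use A' disjoint finite_subset[OF A'] in auto)
    also have "\<dots> \<le> charge x"
      unfolding charge_def by (rule sum_mono2) (use A' in auto)
    finally show ?thesis .
  qed
  have c1: "charge x \<ge> j" if x: "x \<in> A" for x
  proof -
    have "(\<Sum>w\<in>A - {x}. share x w) \<le> charge x"
      using split[of x "A - {x}"] x AQ red AA by fastforce
    moreover have "(\<Sum>w\<in>A - {x}. share x w) = (\<Sum>w\<in>A - {x}. 1)"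
      by (rule sum.cong) (use x red AQ in \<open>auto simp: share_def A_def\<close>)
    ultimately show ?thesis using x fA j_def by simp
  qed
  have c2: "charge x \<ge> 2 * j + 2 * bdeg x" if x: "x \<in> ?Q - A" for x
  proof -
    let ?A' = "{w \<in> A. {x, w} \<in> S}"
    have xn: "\<not> active x" using x A_def by blast
    then have "{w \<in> B x. {x, w} \<in> S} = B x" unfolding active_def nbh_delete_edges by auto
    then have "(\<Sum>w\<in>?A'. share x w) + 2 * bdeg x \<le> charge x"
      using split[of x ?A'] x AQ red unfolding bdeg_def by fastforce
    moreover have "(\<Sum>w\<in>?A'. share x w) = (\<Sum>w\<in>?A'. 2)"
      by (rule sum.cong) (use x red AQ xn in \<open>auto simp: share_def A_def\<close>)
    \<comment> \<open>By \<open>At\<close>, at most one edge from \<open>x\<close> to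
      \<open>A\<close> survives.\<close>
    moreover have "j \<le> card ?A'"
    proof (cases "A \<subseteq> ?A'")
      case True
      then have "A = ?A'" by blast
      then show ?thesis using j_def by simp
    next
      case False
      then obtain a where a: "a \<in> A" "{x, a} \<notin> S" by blast
      then have "A - {a} \<subseteq> ?A'" using At[of x] x by blast
      then have "card (A - {a}) \<le> card ?A'" using fA by (intro card_mono) auto
      then show ?thesis using a fA j_def by simp
    qed
    ultimately show ?thesis by simp
  qed
  have tot: "card A * j + card (?Q - A) * (2 * j) + 2 * (\<Sum>x\<in>?Q - A. bdeg x) \<le> sum charge ?Q"
  proof -
    have "card A * j = (\<Sum>x\<in>A. j)" by simp
    also have "\<dots> \<le> sum charge A" by (rule sum_mono) (rule c1)
    finally have 1: "card A * j \<le> sum charge A" .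
    have "card (?Q - A) * (2 * j) + 2 * (\<Sum>x\<in>?Q - A. bdeg x) = (\<Sum>x\<in>?Q - A. 2 * j + 2 * bdeg x)"
      by (simp add: sum.distrib sum_distrib_left)
    also have "\<dots> \<le> sum charge (?Q - A)" by (rule sum_mono) (rule c2)
    finally have 2: "card (?Q - A) * (2 * j) + 2 * (\<Sum>x\<in>?Q - A. bdeg x) \<le> sum charge (?Q - A)" .
    show ?thesis using 1 2 sum.subset_diff[OF AQ, of charge] by simp
  qed
  show ?thesis
  proof (cases "A = {}")
    case True
    have "v \<in> ?Q" by (simp add: red_clique_def)
    \<comment> \<open>The threshold lemma requires a nonempty set. The singleton \<open>{v}\<close>
      serves: it spares the blue edges at \<open>v\<close> and needs no red deletion.\<close>
    then obtain x where x: "x \<in> ?Q" "cost x \<le> (\<Sum>u\<in>?Q - {v}. bdeg u)"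
      using ex_lex_threshold[of ?Q "{v}" bdeg] cost_unlinked[of _ v] l by (auto)
    have "(\<Sum>u\<in>?Q - {v}. bdeg u) \<le> (\<Sum>u\<in>?Q. bdeg u)" by (rule sum_mono2) auto
    then show ?thesis using tot True x by (intro bexI[of _ x]) auto
  next
    case False
    then obtain x where x: "x \<in> ?Q"
      "cost x \<le> (\<Sum>i<j. card ?Q - 1 - i) + (\<Sum>u\<in>?Q - A. bdeg u)"
      using ex_lex_threshold[of ?Q A bdeg] AQ cost_unlinked[of _ v] l unfolding j_def by auto
    have cA: "card A = Suc j" "card A \<le> card ?Q"
      using False fA j_def AQ by (auto simp: card_gt_0_iff card_mono)
    \<comment> \<open>Twice the number of edges of a complete graph on \<open>s\<close> vertices
      that meet \<open>j\<close> of them. The right side splits it as in \<open>tot\<close>: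
      \<open>j\<close> for each of the \<open>Suc j\<close> vertices of \<open>A\<close>, and
      \<open>2 * j\<close> for each other vertex.\<close>
    have gauss: "2 * (\<Sum>i<j. s - 1 - i) = Suc j * j + (s - Suc j) * (2 * j)" if "Suc j \<le> s" for s
      using that
    proof (induction j)
      case (Suc j)
      then obtain t where "s = Suc (Suc j) + t" using le_Suc_ex by blast
      with Suc show ?case by (simp add: algebra_simps)
    qed simp
    have "card (?Q - A) = card ?Q - card A" using fA AQ by (simp add: card_Diff_subset)
    then have "2 * (\<Sum>i<j. card ?Q - 1 - i) = card A * j + card (?Q - A) * (2 * j)"
      using gauss[of "card ?Q"] cA by simp
    then show ?thesis using x tot by (intro bexI[of _ x]) auto
  qed
qed

text \<open>Three kinds of red cliques occur: a single vertex, which costs nothing, one linked red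
  edge, and an unlinked clique. Minimality of the winner carries a bound for one member over to
  \<open>v\<close>.\<close>

lemma winner_le_charge:
  assumes v: "v \<in> winners"
  shows "2 * cost v \<le> sum charge (red_clique v)"
proof -
  have min: "cost v \<le> cost w" if "w \<in> red_clique v" for w
    using v that unfolding winners_def red_clique_def lex_less_def by force
  consider "R v = {}" | x where "R v \<noteq> {}" "x \<in> red_clique v" "0 < links x"
    | "R v \<noteq> {}" "\<And>x. x \<in> red_clique v \<Longrightarrow> links x = 0" by blast
  then show ?thesis
  proof cases
    case 1
    then show ?thesis by (simp add: cost_def)
  next
    case 3
    then obtain x where "x \<in> red_clique v" "2 * cost x \<le> sum charge (red_clique v)"
      using charge_unlinked by blast
    then show ?thesis using min[of x] by linarith
  next
    case (2 x)
    have "\<exists>w. w \<in> R v \<and> 0 < links v"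
      using 2 linked_red_edge[of _ x] nbh_commute[of x G Red v] unfolding red_clique_def by blast
    then obtain w where w: "w \<in> R v" "0 < links v" by blast
    note s = linked_red_edge[OF w]
    have vw: "v \<noteq> w" using w irrefl by blast
    have Q: "sum charge (red_clique v) = charge v + charge w" "w \<in> red_clique v"
      using s vw by (simp_all add: red_clique_def)
    show ?thesis
    proof (cases "bdeg v + bdeg w < 3")
      case True
      then show ?thesis using s w by (simp add: cost_def)
    next
      case False
      have "below u = 1" if "R u = {x}" "lex_less bdeg x u" for u x
      proof -
        have "{w \<in> R u. lex_less bdeg w u} = {x}" using that by auto
        then show ?thesis by (simp add: below_def)
      qed
      \<comment> \<open>The end that is smaller in the \<open>bdeg\<close> order pays just for the
        red edge, and the winner is no more expensive.\<close>
      then have "cost v = 1 \<or> cost w = 1"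
        using not_lex_less[of bdeg v w] vw s False by (auto simp: cost_def)
      then have "cost v \<le> 1" using min[OF Q(2)] by auto
      then show ?thesis using charge_linked[OF w] False Q(1) by simp
    qed
  qed
qed

text \<open>Two winners in one clique would be red neighbours, and the cheaper would disqualify the
  other. Hence the cliques of winners are disjoint and their charges add up.\<close>

lemma sum_winners_le: "(\<Sum>v\<in>winners. cost v) \<le> card S"
proof -
  have fw: "finite winners" using finite_verts unfolding winners_def by simp
  have disj: "red_clique v \<inter> red_clique w = {}" if "v \<in> winners" "w \<in> winners" "v \<noteq> w" for v w
  proof (rule ccontr)
    assume "red_clique v \<inter> red_clique w \<noteq> {}"
    then have "red_clique v = red_clique w" using red_clique_eq by blast
    then have "w \<in> red_clique v" "v \<in> red_clique w" using red_clique_refl by blast+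
    then have "w \<in> R v" "v \<in> R w" using that(3) by (simp_all add: red_clique_def)
    then show False using that not_lex_less[of cost v w] unfolding winners_def by blast
  qed
  have "2 * (\<Sum>v\<in>winners. cost v) \<le> (\<Sum>v\<in>winners. sum charge (red_clique v))"
    using winner_le_charge by (simp add: sum_distrib_left sum_mono)
  also have "\<dots> = sum charge (\<Union>v\<in>winners. red_clique v)"
    by (rule sum.UNION_disjoint[symmetric]) (use fw disj in auto)
  also have "\<dots> \<le> sum charge (verts G)"
  proof (rule sum_mono2)
    show "(\<Union>v\<in>winners. red_clique v) \<subseteq> verts G"
      using in_verts unfolding winners_def red_clique_def by blast
  qed (use finite_verts in auto)
  finally show ?thesis using sum_charge by linarith
qed

end

section \<open>An optimal deletion\<close>

context class_T_graph
begin

text \<open>In the linked case \<open>3 \<le> bdeg v + bdeg w\<close> excludes exactly the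
  alternating 4-cycle, as both blue degrees are positive there. Otherwise this is the threshold
  deletion priced by \<open>cost v\<close>.\<close>

definition deletion :: "'a \<Rightarrow> 'a set set" where
  "deletion v =
    (if 0 < links v then {{v, w} |w. w \<in> R v \<and> 3 \<le> bdeg v + bdeg w}
     else {{u, w} |u w. u \<in> red_clique v \<and> lex_less bdeg v u \<and> w \<in> R u}
       \<union> {{u, w} |u w. u \<in> red_clique v \<and> lex_less bdeg u v \<and> w \<in> B u})"

lemma deletion_edges: "deletion v \<subseteq> edges G"
  by (auto simp: deletion_def dest: nbh_edges split: if_splits)

text \<open>A union bound. In the unlinked case each deleted red edge is assigned to its larger end,
  which lies above \<open>v\<close> whichever end caused the deletion.\<close>

lemma card_deletion_le_cost: "card (deletion v) \<le> cost v"
proof (cases "0 < links v")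
  case True
  show ?thesis
  proof (cases "\<exists>w. w \<in> R v \<and> 3 \<le> bdeg v + bdeg w")
    case False
    then have "deletion v = {}" using True by (auto simp: deletion_def)
    then show ?thesis by simp
  next
    case ex: True
    then obtain w where w: "w \<in> R v" "3 \<le> bdeg v + bdeg w" by blast
    note s = linked_red_edge[OF w(1) True]
    have "deletion v = {{v, w}}" using True s w by (auto simp: deletion_def)
    moreover have "1 \<le> cost v"
    proof -
      have "0 < bdeg w" using s links_pos_iff[of w] by (auto simp: bdeg_def card_gt_0_iff)
      moreover have "0 < below w" if "lex_less bdeg v w"
        using that s by (auto simp: below_def card_gt_0_iff)
      ultimately show ?thesis
        unfolding cost_def s[THEN conjunct1] using w(2) by (simp add: Suc_le_eq)
    qed
    ultimately show ?thesis by simp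
  qed
next
  case False
  let ?Q = "red_clique v"
  let ?U = "{u. u \<in> ?Q \<and> lex_less bdeg v u}" and ?D = "{u. u \<in> ?Q \<and> lex_less bdeg u v}"
  let ?r = "\<lambda>u. (\<lambda>w. {u, w}) ` {w \<in> ?Q. lex_less bdeg w u}"
  let ?b = "\<lambda>u. (\<lambda>w. {u, w}) ` B u"
  have "deletion v \<subseteq> (\<Union>u\<in>?U. ?r u) \<union> (\<Union>u\<in>?D. ?b u)"
  proof
    fix e assume "e \<in> deletion v"
    then consider u w where "e = {u, w}" "u \<in> ?U" "w \<in> R u" | u w where "e = {u, w}" "u \<in> ?D" "w \<in> B u"
      using False unfolding deletion_def by auto
    then show "e \<in> (\<Union>u\<in>?U. ?r u) \<union> (\<Union>u\<in>?D. ?b u)"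
    proof cases
      case 1
      then have "w \<in> ?Q" "u \<noteq> w" using red_nbh_eq[of u v] by auto
      then consider "lex_less bdeg w u" | "lex_less bdeg u w" using not_lex_less by blast
      then show ?thesis
      proof cases
        case 1
        then show ?thesis using \<open>w \<in> ?Q\<close> \<open>e = {u, w}\<close> \<open>u \<in> ?U\<close> by blast
      next
        case 2
        then have "w \<in> ?U" using \<open>w \<in> ?Q\<close> \<open>u \<in> ?U\<close> lex_less_trans by blast
        moreover have "e \<in> ?r w" using 2 \<open>e = {u, w}\<close> \<open>u \<in> ?U\<close> by (auto simp: insert_commute)
        ultimately show ?thesis by blast
      qed
    next
      case 2
      then show ?thesis by blast
    qed
  qed
  then have "card (deletion v) \<le> card ((\<Union>u\<in>?U. ?r u) \<union> (\<Union>u\<in>?D. ?b u))"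
    by (intro card_mono) auto
  also have "\<dots> \<le> card (\<Union>u\<in>?U. ?r u) + card (\<Union>u\<in>?D. ?b u)" by (rule card_Un_le)
  also have "card (\<Union>u\<in>?U. ?r u) \<le> (\<Sum>u\<in>?U. card (?r u))" by (rule card_UN_le) simp
  also have "\<dots> \<le> (\<Sum>u\<in>?U. card {w \<in> ?Q. lex_less bdeg w u})"
    by (rule sum_mono) (simp add: card_image_le)
  also have "card (\<Union>u\<in>?D. ?b u) \<le> (\<Sum>u\<in>?D. card (?b u))" by (rule card_UN_le) simp
  also have "\<dots> \<le> (\<Sum>u\<in>?D. bdeg u)"
    unfolding bdeg_def by (rule sum_mono) (simp add: card_image_le)
  finally show ?thesis using cost_unlinked[of v v] False by simp
qed

text \<open>The member with \<open>card (red_clique v) - 1\<close> others above it in the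
  \<open>cost\<close> order is the minimum of its clique.\<close>

lemma ex_winner: "v \<in> verts G \<Longrightarrow> \<exists>w\<in>winners. v \<in> red_clique w"
proof -
  assume v: "v \<in> verts G"
  have "0 < card (red_clique v)" by (simp add: red_clique_def card_gt_0_iff)
  then obtain w where w: "w \<in> red_clique v"
    "card {u \<in> red_clique v. lex_less cost w u} = card (red_clique v) - 1"
    using ex_card_above[of "red_clique v" "card (red_clique v) - 1" cost] by auto
  then have "card {u \<in> red_clique v. lex_less cost u w} = 0"
    using card_below[of "red_clique v" w cost] by simp
  then have "{u \<in> red_clique v. lex_less cost u w} = {}" by simp
  moreover have "w \<in> verts G" using w v in_verts unfolding red_clique_def by blast
  ultimately have "w \<in> winners" using red_nbh_eq[OF w(1)] unfolding winners_def by auto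
  moreover have "v \<in> red_clique w" using red_clique_eq[OF w(1)] by simp
  ultimately show ?thesis by blast
qed

definition optimal_deletion :: "'a set set" where
  "optimal_deletion = (\<Union>v\<in>winners. deletion v)"

lemma winner_unique:
  assumes "v \<in> winners" "w \<in> winners" "w \<in> red_clique v"
  shows "v = w"
  using assms not_lex_less[of cost v w] nbh_commute[of w G Red v]
  unfolding winners_def red_clique_def by blast

lemma links_red_clique: "x \<in> red_clique v \<Longrightarrow> 0 < links x \<longleftrightarrow> 0 < links v"
  using linked_red_edge[of x v] linked_red_edge[of v x] nbh_commute[of x G Red v]
  unfolding red_clique_def by blast

text \<open>Traces a deleted red edge back to the clique and the rule responsible for it, so that
  survival of an edge can be shown by excluding all winners.\<close>

lemma deletion_red:
  assumes "{a, b} \<in> deletion q" "b \<in> R a"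
  shows "a \<in> red_clique q"
    and "0 < links q \<Longrightarrow> 3 \<le> bdeg a + bdeg b"
    and "links q = 0 \<Longrightarrow> lex_less bdeg q a \<or> lex_less bdeg q b"
proof -
  have ba: "a \<in> R b" using assms(2) nbh_commute[of b] by blast
  have "a \<in> red_clique q \<and> (0 < links q \<longrightarrow> 3 \<le> bdeg a + bdeg b)
    \<and> (links q = 0 \<longrightarrow> lex_less bdeg q a \<or> lex_less bdeg q b)"
  proof (cases "0 < links q")
    case True
    then obtain w where "{a, b} = {q, w}" "w \<in> R q" "3 \<le> bdeg q + bdeg w"
      using assms(1) by (auto simp: deletion_def)
    then show ?thesis using True by (auto simp: red_clique_def doubleton_eq_iff)
  next
    case False
    then consider u w where "{a, b} = {u, w}" "u \<in> red_clique q" "lex_less bdeg q u" "w \<in> R u"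
      | u w where "{a, b} = {u, w}" "w \<in> B u"
      using assms(1) by (auto simp: deletion_def)
    then show ?thesis
    proof cases
      case 1
      then have "w \<in> red_clique q" using red_nbh_eq by blast
      then show ?thesis using 1 False by (auto simp: doubleton_eq_iff)
    next
      case 2
      then show ?thesis using assms(2) ba disjoint by (auto simp: doubleton_eq_iff)
    qed
  qed
  then show "a \<in> red_clique q" "0 < links q \<Longrightarrow> 3 \<le> bdeg a + bdeg b"
    "links q = 0 \<Longrightarrow> lex_less bdeg q a \<or> lex_less bdeg q b" by blast+
qed

lemma deletion_blue:
  assumes "{a, b} \<in> deletion q" "b \<in> B a"
  shows "links q = 0"
    and "a \<in> red_clique q \<and> lex_less bdeg a q \<or> b \<in> red_clique q \<and> lex_less bdeg b q"
proof -
  have nR: "b \<notin> R a" "a \<notin> R b" using assms(2) nbh_commute[of b] disjoint by blast+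
  show l: "links q = 0"
    using assms(1) nR by (auto simp: deletion_def doubleton_eq_iff split: if_splits)
  show "a \<in> red_clique q \<and> lex_less bdeg a q \<or> b \<in> red_clique q \<and> lex_less bdeg b q"
    using assms(1) nR l by (auto simp: deletion_def doubleton_eq_iff)
qed

text \<open>At a colour change \<open>v\<close> of a surviving path, \<open>x\<close> and
  \<open>w\<close> are the path neighbours and \<open>z\<close> is the fourth vertex, attached to
  either. In the linked case the surviving red edge lies on an untouched 4-cycle that leaves no room
  for \<open>z\<close>. In the unlinked case \<open>v\<close> must be the winner itself, and then
  \<open>z\<close> is adjacent to \<open>v\<close> or its edge was deleted.\<close>

lemma optimal_deletion_no_P4:
  fixes x v w :: 'a
  defines "N \<equiv> nbh (delete_edges G optimal_deletion)"
  assumes x: "v \<in> N Blue x" and w: "w \<in> N Red v"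
    and z: "z \<in> N h w \<and> (\<forall>k. z \<notin> N k v \<and> z \<notin> N k x)
      \<or> z \<in> N h x \<and> (\<forall>k. z \<notin> N k v \<and> z \<notin> N k w)"
  shows False
proof -
  let ?S = optimal_deletion
  note c = nbh_commute[THEN iffD1]
  have iff: "w \<in> N h v \<longleftrightarrow> w \<in> nbh G h v \<and> {v, w} \<notin> ?S" for w h v
    by (simp add: N_def nbh_delete_edges)
  have "v \<in> N Red w" using c[OF w[unfolded N_def]] by (simp add: N_def)
  then have zv: "z \<noteq> v" using z x by blast
  have vx: "v \<in> B x" "{x, v} \<notin> ?S" "{v, x} \<notin> ?S" using x by (simp_all add: iff insert_commute)
  have xv: "x \<in> B v" using c[OF vx(1)] .
  have vw: "w \<in> R v" "{v, w} \<notin> ?S" using w by (simp_all add: iff)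
  have wv: "v \<in> R w" using c[OF vw(1)] .
  obtain q where q: "q \<in> winners" "v \<in> red_clique q" using ex_winner vx(1) in_verts by blast
  have Q: "red_clique v = red_clique q" using red_clique_eq q by blast
  have wq: "w \<in> red_clique q" using vw(1) Q by (auto simp: red_clique_def)
  have in_S: "\<exists>p\<in>winners. e \<in> deletion p" if "e \<in> ?S" for e
    using that unfolding optimal_deletion_def by blast
  have not_S: "e \<notin> deletion q" if "e \<notin> ?S" for e
    using that q(1) unfolding optimal_deletion_def by blast
  show False
  proof (cases "0 < links q")
    case True
    have lv: "0 < links v" using True links_red_clique q(2) by blast
    note s = linked_red_edge[OF vw(1) lv]
    have lt: "bdeg v + bdeg w < 3"
    proof (rule ccontr)
      assume n: "\<not> ?thesis"
      have "q = v \<or> q = w" using s Q red_clique_refl[of q] by (auto simp: red_clique_def)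
      then have "{v, w} \<in> deletion q"
      proof
        assume "q = v"
        then show ?thesis using n True vw by (auto simp: deletion_def)
      next
        assume "q = w"
        then have "{w, v} \<in> deletion q" using n True wv by (auto simp: deletion_def)
        then show ?thesis by (simp add: insert_commute)
      qed
      then show False using vw(2) not_S by blast
    qed
    moreover have pos: "0 < bdeg v" "0 < bdeg w"
      using s lv links_pos_iff[of v] links_pos_iff[of w] by (auto simp: bdeg_def card_gt_0_iff)
    ultimately have "card (B v) = 1" "card (B w) = 1" unfolding bdeg_def by auto
    then obtain y where Bs: "B v = {x}" "B w = {y}" using xv by (auto simp: card_1_singleton_iff)
    then obtain y' where y': "y' \<in> R x" using lv links_pos_iff[of v] by auto
    then have "y' \<in> B w" using alternating_square[OF wv xv] by blast
    then have xy: "y \<in> R x" using Bs y' by auto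
    have lx: "0 < links x" using links_pos_iff[of x] vx(1) vw(1) by auto
    have yw: "y \<in> B w" using Bs by simp
    have ly: "0 < links y" using links_pos_iff[of y] c[OF yw] wv by auto
    have Rx: "R x = {y}" using linked_red_edge[OF xy lx] by simp
    have Bx: "B x = {v}"
    proof -
      have "u = v" if "u \<in> B x" for u
        using mono_transitive[OF xv that] Bs(1) that by (cases "v = u") auto
      then show ?thesis using vx by blast
    qed
    have By: "B y = {w}"
    proof -
      have "u = w" if "u \<in> B y" for u
        using mono_transitive[OF yw that] Bs(2) that by (cases "w = u") auto
      then show ?thesis using c[OF yw] by blast
    qed
    have Sxy: "{x, y} \<notin> ?S"
    proof
      assume "{x, y} \<in> ?S"
      then obtain p where p: "p \<in> winners" "{x, y} \<in> deletion p" using in_S by blast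
      note d = deletion_red[OF p(2) xy]
      have "0 < links p" using links_red_clique[OF d(1)] lx by simp
      then have "3 \<le> bdeg x + bdeg y" by (rule d(2))
      then show False using Bx By by (simp add: bdeg_def)
    qed
    have Swy: "{w, y} \<notin> ?S"
    proof
      assume "{w, y} \<in> ?S"
      then obtain p where p: "p \<in> winners" "{w, y} \<in> deletion p" using in_S by blast
      note d = deletion_blue[OF p(2) yw]
      show False using d(1) d(2) links_red_clique[of w p] links_red_clique[of y p] s ly by auto
    qed
    have N: "y \<in> N Red x" "y \<in> N Blue w"
      using xy Sxy yw Swy by (simp_all add: iff)
    \<comment> \<open>The four vertices form a whole component, and \<open>y\<close> is adjacent to
      both \<open>x\<close> and \<open>w\<close> after the deletion.\<close>
    have "z = y" using z zv iff Bs s Rx Bx by (cases h) auto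
    then show False using z N by blast
  next
    case False
    then have l0: "links q = 0" "links v = 0" using links_red_clique[OF q(2)] by auto
    have un: "R u = {}" if "u \<in> B v" for u
      using that l0(2) links_pos_iff[of v] by auto
    have "\<not> lex_less bdeg v q"
    proof
      assume "lex_less bdeg v q"
      then have "{v, x} \<in> deletion q" using q(2) xv l0 by (auto simp: deletion_def)
      then show False using vx not_S by blast
    qed
    moreover have red_kept: "\<not> lex_less bdeg q u" if "u \<in> red_clique q" "u' \<in> R u" "{u, u'} \<notin> ?S" for u u'
    proof
      assume "lex_less bdeg q u"
      then have "{u, u'} \<in> deletion q" using that l0 by (auto simp: deletion_def)
      then show False using that not_S by blast
    qed
    \<comment> \<open>A member above the winner loses its red edges and one below it its blue edges,
      but \<open>v\<close> keeps one of each.\<close>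
    ultimately have vq: "v = q" using q(2) vw not_lex_less by blast
    have "{w, v} \<notin> ?S" using vw by (simp add: insert_commute)
    then have "\<not> lex_less bdeg q w" using red_kept[OF wq wv] by blast
    moreover have "w \<noteq> q" using vw vq irrefl by blast
    ultimately have wl: "lex_less bdeg w q" using not_lex_less by blast
    from z show False
    proof
      assume z: "z \<in> N h w \<and> (\<forall>k. z \<notin> N k v \<and> z \<notin> N k x)"
      then have wz: "z \<in> nbh G h w" "{w, z} \<notin> ?S" "{z, w} \<notin> ?S" by (simp_all add: iff insert_commute)
      show False
      proof (cases h)
        case Blue
        then have "{w, z} \<in> deletion q" using wl wq wz l0 by (auto simp: deletion_def)
        then show False using wz not_S by blast
      next
        case Red
        then have "z \<in> R w" using wz by simp
        then have zR: "z \<in> R v" using mono_transitive[OF vw(1)] zv by blast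
        then have "{v, z} \<in> ?S" using z iff by blast
        then obtain p where p: "p \<in> winners" "{v, z} \<in> deletion p" using in_S by blast
        note d = deletion_red[OF p(2) zR]
        have "p = q" using winner_unique[OF p(1) q(1)] d(1) vq by blast
        \<comment> \<open>An edge from \<open>q\<close> to \<open>z\<close> is deleted only if
          \<open>z\<close> lies above \<open>q\<close>, but then the edge from \<open>z\<close> to
          \<open>w\<close> is deleted as well.\<close>
        then have "lex_less bdeg q z" using d(3) l0 vq by auto
        moreover have "z \<in> red_clique q" using zR vq unfolding red_clique_def by blast
        ultimately show False using red_kept[OF _ c[OF \<open>z \<in> R w\<close>] wz(3)] by blast
      qed
    next
      assume z: "z \<in> N h x \<and> (\<forall>k. z \<notin> N k v \<and> z \<notin> N k w)"
      then have zx: "z \<in> nbh G h x" by (simp add: iff)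
      have zB: "z \<in> B v"
        using zx un[OF xv] mono_transitive[OF xv, of z] zv by (cases h) auto
      then have "{v, z} \<in> ?S" using z iff by blast
      then obtain p where p: "p \<in> winners" "{v, z} \<in> deletion p" using in_S by blast
      \<comment> \<open>The deletion must have been caused by one of the two ends: \<open>v\<close>
        is not below itself, and \<open>z\<close> has no red neighbour that could be its
        winner.\<close>
      from deletion_blue(2)[OF p(2) zB] show False
      proof
        assume a: "v \<in> red_clique p \<and> lex_less bdeg v p"
        then have "p = q" using winner_unique[OF p(1) q(1)] vq by blast
        then show False using a vq by simp
      next
        assume a: "z \<in> red_clique p \<and> lex_less bdeg z p"
        then have "p \<in> red_clique z" "p \<noteq> z" using red_clique_eq[of z p] by auto
        then show False using un[OF zB] by (simp add: red_clique_def)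
      qed
    qed
  qed
qed

text \<open>A bicolored path changes colour at one of its two inner vertices, in one of two orders;
  that vertex takes the role of \<open>v\<close> above.\<close>

lemma optimal_deletion_free: "bicolored_P4_free (delete_edges G optimal_deletion)"
  unfolding bicolored_P4_free_iff[OF bicolored_graph_delete_edges[OF bicolored]]
proof (intro allI impI)
  let ?N = "nbh (delete_edges G optimal_deletion)"
  fix x y z a b c d
  assume p: "induced_P4 (delete_edges G optimal_deletion) x y z a b c d"
  have e: "b \<in> ?N x a" "c \<in> ?N y b" "d \<in> ?N z c" "a \<in> ?N x b" "b \<in> ?N y c" "c \<in> ?N z d"
    using p unfolding induced_P4_def by (simp_all add: nbh_commute)
  have n: "c \<notin> ?N h a" "d \<notin> ?N h b" "d \<notin> ?N h a" "a \<notin> ?N h c" "b \<notin> ?N h d" "a \<notin> ?N h d" for h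
    using p unfolding induced_P4_def by (simp_all add: nbh_commute)
  show "x = y \<and> y = z"
  proof (rule ccontr)
    assume "\<not> ?thesis"
    then consider "x = Blue" "y = Red" | "x = Red" "y = Blue" | "y = Blue" "z = Red" | "y = Red" "z = Blue"
      by (cases x; cases y; cases z) auto
    then show False
    proof cases
      case 1
      then show False using optimal_deletion_no_P4[of b a c d z] e n by blast
    next
      case 2
      then show False using optimal_deletion_no_P4[of b c a d z] e n by blast
    next
      case 3
      then show False using optimal_deletion_no_P4[of c b d a x] e n by blast
    next
      case 4
      then show False using optimal_deletion_no_P4[of c d b a x] e n by blast
    qed
  qed
qed

theorem two_colored_P4_deletion_iff:
  "two_colored_P4_deletion G k \<longleftrightarrow> int (\<Sum>v\<in>winners. cost v) \<le> k"
proof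
  assume "two_colored_P4_deletion G k"
  then obtain S where S: "S \<subseteq> edges G" "int (card S) \<le> k" "bicolored_P4_free (delete_edges G S)"
    unfolding two_colored_P4_deletion_def by blast
  interpret P4_deletion G S by unfold_locales (use S in auto)
  show "int (\<Sum>v\<in>winners. cost v) \<le> k" using sum_winners_le S(2) by linarith
next
  assume k: "int (\<Sum>v\<in>winners. cost v) \<le> k"
  have "finite winners" using finite_verts unfolding winners_def by simp
  then have "card optimal_deletion \<le> (\<Sum>v\<in>winners. card (deletion v))"
    unfolding optimal_deletion_def by (rule card_UN_le)
  also have "\<dots> \<le> (\<Sum>v\<in>winners. cost v)" by (rule sum_mono) (rule card_deletion_le_cost)
  finally have "int (card optimal_deletion) \<le> k" using k by linarith
  moreover have "optimal_deletion \<subseteq> edges G"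
    using deletion_edges unfolding optimal_deletion_def by blast
  ultimately show "two_colored_P4_deletion G k"
    using optimal_deletion_free unfolding two_colored_P4_deletion_def by blast
qed

end

section \<open>Random access machine programs\<close>

text \<open>Evaluates loop-free programs by simplification. The value for loops is a dummy, and
  \<open>safe\<close> excludes them along with negative addresses.\<close>

fun run :: "ram \<Rightarrow> state \<Rightarrow> state" where
  "run (Const i c) (r, M) = (r(i := c), M)"
| "run (Move i j) (r, M) = (r(i := r j), M)"
| "run (Add i j l) (r, M) = (r(i := r j + r l), M)"
| "run (Sub i j l) (r, M) = (r(i := r j - r l), M)"
| "run (Load i j) (r, M) = (r(i := M (nat (r j))), M)"
| "run (Store i j) (r, M) = (r, M(nat (r i) := r j))"
| "run (Seq p q) s = run q (run p s)"
| "run (IfLess i j p q) (r, M) = (if r i < r j then run p (r, M) else run q (r, M))"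
| "run (WhileLess i j p) s = s"

fun safe :: "ram \<Rightarrow> state \<Rightarrow> bool" where
  "safe (Load i j) (r, M) \<longleftrightarrow> 0 \<le> r j"
| "safe (Store i j) (r, M) \<longleftrightarrow> 0 \<le> r i"
| "safe (Seq p q) s \<longleftrightarrow> safe p s \<and> safe q (run p s)"
| "safe (IfLess i j p q) (r, M) \<longleftrightarrow> (if r i < r j then safe p (r, M) else safe q (r, M))"
| "safe (WhileLess i j p) s \<longleftrightarrow> False"
| "safe _ s \<longleftrightarrow> True"

text \<open>Adding up both branches of a conditional gives a bound that does not depend on the
  state.\<close>

fun steps :: "ram \<Rightarrow> nat" where
  "steps (Seq p q) = steps p + steps q"
| "steps (IfLess i j p q) = 1 + steps p + steps q"
| "steps _ = 1"

lemma exec_run: "safe p s \<Longrightarrow> \<exists>t\<le>steps p. exec p s t (run p s)"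
proof (induction p arbitrary: s)
  case (Seq p q)
  then have "safe p s" "safe q (run p s)" by simp_all
  then obtain t t' where "t \<le> steps p" "exec p s t (run p s)"
    "t' \<le> steps q" "exec q (run p s) t' (run q (run p s))" using Seq.IH by blast
  then show ?case
    by (intro exI[of _ "t + t'"]) (auto intro: exec.Seq)
next
  case (IfLess i j p q)
  obtain r M where s: "s = (r, M)" by (cases s)
  show ?case
  proof (cases "r i < r j")
    case True
    then have "safe p s" using IfLess.prems s by simp
    then obtain t where "t \<le> steps p" "exec p s t (run p s)" using IfLess.IH by blast
    then show ?thesis using True s by (intro exI[of _ "1 + t"]) (auto intro: exec.IfTrue[simplified])
  next
    case False
    then have "safe q s" using IfLess.prems s by simp
    then obtain t where "t \<le> steps q" "exec q s t (run q s)" using IfLess.IH by blast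
    then show ?thesis using False s by (intro exI[of _ "1 + t"]) (auto intro: exec.IfFalse[simplified])
  qed
next
  case (WhileLess i j p)
  then show ?case by simp
next
  case (Const i c)
  then show ?case by (cases s) (auto intro!: exI[of _ "Suc 0"] exec.Const[simplified])
next
  case (Move i j)
  then show ?case by (cases s) (auto intro!: exI[of _ "Suc 0"] exec.Move[simplified])
next
  case (Add i j l)
  then show ?case by (cases s) (auto intro!: exI[of _ "Suc 0"] exec.Add[simplified])
next
  case (Sub i j l)
  then show ?case by (cases s) (auto intro!: exI[of _ "Suc 0"] exec.Sub[simplified])
next
  case (Load i j)
  then show ?case by (cases s) (auto intro!: exI[of _ "Suc 0"] exec.Load[simplified])
next
  case (Store i j)
  then show ?case by (cases s) (auto intro!: exI[of _ "Suc 0"] exec.Store[simplified])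
qed

section \<open>Memory layout and array access\<close>

type_synonym edge_list = "(nat \<times> nat \<times> colour) list"
type_synonym arrays = "nat \<Rightarrow> nat \<Rightarrow> int"

definition input_code :: "edge_list \<Rightarrow> int list" where
  "input_code es = concat (map edge_code es)"

lemma length_edge_code[simp]: "length (edge_code e) = 3"
  by (cases e) simp

lemma length_input_code[simp]: "length (input_code es) = 3 * length es"
  by (induction es) (simp_all add: input_code_def)

lemma nth_input_code:
  "j < 3 \<Longrightarrow> input_code (xs @ e # ys) ! (3 * length xs + j) = edge_code e ! j"
proof -
  assume "j < 3"
  moreover have "input_code (xs @ e # ys) = input_code xs @ edge_code e @ input_code ys"
    by (simp add: input_code_def)
  ultimately show ?thesis
    using nth_append_length_plus[of "input_code xs" "edge_code e @ input_code ys" j]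
    by (simp add: nth_append)
qed

text \<open>Cell \<open>v\<close> of array \<open>i < 8\<close> is stored at address \<open>3 m + 8 v + i\<close>, behind the input.\<close>

definition mem :: "edge_list \<Rightarrow> arrays \<Rightarrow> nat \<Rightarrow> int" where
  "mem es \<sigma> a = (if a < 3 * length es then input_code es ! a
     else \<sigma> ((a - 3 * length es) mod 8) ((a - 3 * length es) div 8))"

text \<open>Three doublings replace the multiplication by 8. Registers 20 and 21 are reserved for
  this computation.\<close>

definition address :: "nat \<Rightarrow> nat \<Rightarrow> ram" where
  "address i v = Seq (Add 20 v v) (Seq (Add 20 20 20) (Seq (Add 20 20 20)
     (Seq (Add 20 20 3) (Seq (Const 21 (int i)) (Add 20 20 21)))))"

definition get :: "nat \<Rightarrow> nat \<Rightarrow> nat \<Rightarrow> ram" where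
  "get x i v = Seq (address i v) (Load x 20)"

definition put :: "nat \<Rightarrow> nat \<Rightarrow> nat \<Rightarrow> ram" where
  "put i v x = Seq (address i v) (Store 20 x)"

lemma mem_cell: "i < 8 \<Longrightarrow> mem es \<sigma> (3 * length es + 8 * u + i) = \<sigma> i u"
  by (simp add: mem_def)

lemma mem_update:
  assumes "i < 8"
  shows "(mem es \<sigma>)(3 * length es + 8 * u + i := y) = mem es (\<sigma>(i := (\<sigma> i)(u := y)))"
proof
  fix a
  have "a = 3 * length es + 8 * u + i \<longleftrightarrow>
    3 * length es \<le> a \<and> (a - 3 * length es) mod 8 = i \<and> (a - 3 * length es) div 8 = u"
    using assms by auto
  then show "((mem es \<sigma>)(3 * length es + 8 * u + i := y)) a = mem es (\<sigma>(i := (\<sigma> i)(u := y))) a"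
    by (auto simp: mem_def)
qed

lemma run_address:
  assumes "r 3 = int (3 * length es)" "0 \<le> r v" "v \<noteq> 20" "v \<noteq> 21"
  shows "run (address i v) (r, M) =
    (r(20 := int (3 * length es + 8 * nat (r v) + i), 21 := int i), M)"
  using assms by (auto simp: address_def fun_eq_iff)

lemma safe_address: "safe (address i v) s"
  by (cases s) (simp add: address_def)

lemma run_get[simp]:
  assumes "r 3 = int (3 * length es)" "0 \<le> r v" "i < 8" "v \<noteq> 20" "v \<noteq> 21"
  shows "run (get x i v) (r, mem es \<sigma>) =
      (r(20 := int (3 * length es + 8 * nat (r v) + i), 21 := int i, x := \<sigma> i (nat (r v))), mem es \<sigma>)"
    and "safe (get x i v) (r, mem es \<sigma>)"
  using assms mem_cell[OF assms(3)]
  by (simp_all add: get_def run_address[OF assms(1,2,4,5)] safe_address nat_int del: of_nat_add of_nat_mult)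

lemma run_put[simp]:
  assumes "r 3 = int (3 * length es)" "0 \<le> r v" "i < 8" "v \<noteq> 20" "v \<noteq> 21" "x \<noteq> 20" "x \<noteq> 21"
  shows "run (put i v x) (r, mem es \<sigma>) =
      (r(20 := int (3 * length es + 8 * nat (r v) + i), 21 := int i),
       mem es (\<sigma>(i := (\<sigma> i)(nat (r v) := r x))))"
    and "safe (put i v x) (r, mem es \<sigma>)"
  using assms mem_update[OF assms(3)]
  by (simp_all add: put_def run_address[OF assms(1,2,4,5)] safe_address nat_int del: of_nat_add of_nat_mult)

text \<open>Registers: 2 holds \<open>k\<close>, 3 the array base \<open>3 m\<close>, 4 the input pointer, 5 and 6 the constants 1 and 0;
  7, 8, 9 hold the current arc \<open>(u, v, c)\<close>. All others are scratch, with results of expressions in 11.\<close>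

definition ready :: "edge_list \<Rightarrow> (nat \<Rightarrow> int) \<Rightarrow> bool" where
  "ready es r \<longleftrightarrow> r 3 = int (3 * length es) \<and> r 5 = 1 \<and> r 6 = 0"

definition at_arc :: "(nat \<Rightarrow> int) \<Rightarrow> nat \<Rightarrow> nat \<Rightarrow> colour \<Rightarrow> bool" where
  "at_arc r u v c \<longleftrightarrow> r 7 = int u \<and> r 8 = int v \<and> r 9 = (case c of Blue \<Rightarrow> 0 | Red \<Rightarrow> 1)"

text \<open>An arc is an oriented edge. Preserving the registers up to 9 protects the constants, the
  input pointer and the current arc.\<close>

definition arc_step ::
  "edge_list \<Rightarrow> ram \<Rightarrow> (nat \<Rightarrow> nat \<Rightarrow> colour \<Rightarrow> arrays \<Rightarrow> arrays) \<Rightarrow> bool" where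
  "arc_step es p f \<longleftrightarrow> (\<forall>r \<sigma> u v c. ready es r \<and> at_arc r u v c \<longrightarrow>
     safe p (r, mem es \<sigma>) \<and>
     (\<exists>r'. run p (r, mem es \<sigma>) = (r', mem es (f u v c \<sigma>)) \<and> (\<forall>i\<le>9. r' i = r i)))"

definition arc_expr ::
  "edge_list \<Rightarrow> ram \<Rightarrow> (arrays \<Rightarrow> nat \<Rightarrow> nat \<Rightarrow> colour \<Rightarrow> int) \<Rightarrow> bool" where
  "arc_expr es p g \<longleftrightarrow> (\<forall>r \<sigma> u v c. ready es r \<and> at_arc r u v c \<longrightarrow>
     safe p (r, mem es \<sigma>) \<and>
     (\<exists>r'. run p (r, mem es \<sigma>) = (r', mem es \<sigma>) \<and> r' 11 = g \<sigma> u v c \<and> (\<forall>i\<le>9. r' i = r i)))"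

definition add_to :: "nat \<Rightarrow> (arrays \<Rightarrow> nat \<Rightarrow> nat \<Rightarrow> colour \<Rightarrow> int) \<Rightarrow>
    nat \<Rightarrow> nat \<Rightarrow> colour \<Rightarrow> arrays \<Rightarrow> arrays" where
  "add_to i g u v c \<sigma> = \<sigma>(i := (\<sigma> i)(u := \<sigma> i u + g \<sigma> u v c))"

definition accumulate :: "nat \<Rightarrow> ram \<Rightarrow> ram" where
  "accumulate i p = Seq p (Seq (get 12 i 7) (Seq (Add 12 12 11) (put i 7 12)))"

lemma arc_step_accumulate:
  assumes p: "arc_expr es p g" and i: "i < 8"
  shows "arc_step es (accumulate i p) (add_to i g)"
  unfolding arc_step_def
proof (intro allI impI)
  fix r \<sigma> u v c
  assume r: "ready es r \<and> at_arc r u v c"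
  then obtain r' where r': "safe p (r, mem es \<sigma>)" "run p (r, mem es \<sigma>) = (r', mem es \<sigma>)"
    "r' 11 = g \<sigma> u v c" "\<forall>i\<le>9. r' i = r i"
    using p unfolding arc_expr_def by blast
  have "r' 3 = int (3 * length es)" "r' 7 = int u"
    using r r'(4) by (auto simp: ready_def at_arc_def)
  then show "safe (accumulate i p) (r, mem es \<sigma>) \<and> (\<exists>r''. run (accumulate i p) (r, mem es \<sigma>)
      = (r'', mem es (add_to i g u v c \<sigma>)) \<and> (\<forall>i\<le>9. r'' i = r i))"
    using r' i by (auto simp: accumulate_def add_to_def)
qed

section \<open>Passes over the edge list\<close>

definition pass_body :: "ram \<Rightarrow> ram" where
  "pass_body p = Seq (Load 7 4) (Seq (Add 4 4 5) (Seq (Load 8 4) (Seq (Add 4 4 5)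
     (Seq (Load 9 4) (Seq (Add 4 4 5) (Seq p (Seq (Move 10 7) (Seq (Move 7 8) (Seq (Move 8 10) p)))))))))"

definition pass :: "ram \<Rightarrow> ram" where
  "pass p = Seq (Const 4 0) (WhileLess 4 3 (pass_body p))"

definition arcs :: "edge_list \<Rightarrow> edge_list" where
  "arcs es = concat (map (\<lambda>(u, v, c). [(u, v, c), (v, u, c)]) es)"

text \<open>The body treats both orientations of an edge, swapping its ends through register 10;
  this is what makes every pass a sum over neighbourhoods.\<close>

lemma run_pass_body:
  assumes p: "arc_step es p f" and es: "es = xs @ (u, v, c) # ys"
    and r: "ready es r" "r 4 = int (3 * length xs)"
  shows "safe (pass_body p) (r, mem es \<sigma>) \<and>
    (\<exists>r'. run (pass_body p) (r, mem es \<sigma>) = (r', mem es (f v u c (f u v c \<sigma>))) \<and>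
      ready es r' \<and> r' 4 = int (3 * length (xs @ [(u, v, c)])) \<and> r' 2 = r 2)"
proof -
  have m: "mem es \<sigma> (3 * length xs + j) = edge_code (u, v, c) ! j" if "j < 3" for j
    using that nth_input_code[OF that, of xs "(u, v, c)" ys] by (simp add: mem_def es)
  have m0: "mem es \<sigma> (3 * length xs) = int u" "mem es \<sigma> (Suc (3 * length xs)) = int v"
    "mem es \<sigma> (Suc (Suc (3 * length xs))) = (case c of Blue \<Rightarrow> 0 | Red \<Rightarrow> 1)"
    using m[of 0] m[of 1] m[of 2] by simp_all
  define r1 where "r1 = r(7 := int u, 8 := int v, 9 := (case c of Blue \<Rightarrow> 0 | Red \<Rightarrow> (1::int)),
    4 := int (3 * length xs) + 3)"
  have 1: "ready es r1 \<and> at_arc r1 u v c" using r(1) by (simp add: r1_def ready_def at_arc_def)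
  then obtain r2 where r2: "safe p (r1, mem es \<sigma>)"
    "run p (r1, mem es \<sigma>) = (r2, mem es (f u v c \<sigma>))" "\<forall>i\<le>9. r2 i = r1 i"
    using p unfolding arc_step_def by blast
  define r3 where "r3 = r2(10 := r2 7, 7 := r2 8, 8 := r2 7)"
  have 3: "ready es r3 \<and> at_arc r3 v u c" using 1 r2(3) by (simp add: r3_def ready_def at_arc_def)
  then obtain r4 where r4: "safe p (r3, mem es (f u v c \<sigma>))"
    "run p (r3, mem es (f u v c \<sigma>)) = (r4, mem es (f v u c (f u v c \<sigma>)))" "\<forall>i\<le>9. r4 i = r3 i"
    using p unfolding arc_step_def by blast
  have a: "nat (3 * int (length xs)) = 3 * length xs"
    "nat (3 * int (length xs) + 1) = Suc (3 * length xs)"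
    "nat (2 + 3 * int (length xs)) = Suc (Suc (3 * length xs))" by linarith+
  let ?pre = "Seq (Load 7 4) (Seq (Add 4 4 5) (Seq (Load 8 4) (Seq (Add 4 4 5)
     (Seq (Load 9 4) (Add 4 4 5)))))"
  have pre: "run ?pre (r, mem es \<sigma>) = (r1, mem es \<sigma>) \<and> safe ?pre (r, mem es \<sigma>)"
    using r m0 a by (auto simp: ready_def r1_def fun_eq_iff)
  \<comment> \<open>The body is cut at the two calls of \<open>p\<close>, whose effect is known only
    through \<open>arc_step\<close>.\<close>
  have eq: "run (pass_body p) s = run p (run (Seq (Move 10 7) (Seq (Move 7 8) (Move 8 10))) (run p (run ?pre s)))"
    "safe (pass_body p) s \<longleftrightarrow> safe ?pre s \<and> safe p (run ?pre s) \<and>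
      safe (Seq (Move 10 7) (Seq (Move 7 8) (Move 8 10))) (run p (run ?pre s)) \<and>
      safe p (run (Seq (Move 10 7) (Seq (Move 7 8) (Move 8 10))) (run p (run ?pre s)))" for s
    by (auto simp: pass_body_def)
  have mid: "run (Seq (Move 10 7) (Seq (Move 7 8) (Move 8 10))) (r2, M) = (r3, M)"
    "safe (Seq (Move 10 7) (Seq (Move 7 8) (Move 8 10))) (r2, M)" for M
    by (auto simp: r3_def fun_eq_iff)
  have "ready es r4" "r4 4 = int (3 * length (xs @ [(u, v, c)]))" "r4 2 = r 2"
    using 3 r4(3) r2(3) by (auto simp: ready_def r3_def r1_def)
  then show ?thesis
    unfolding eq using pre r2 r4 mid by auto
qed

text \<open>Induction on the unread part \<open>ys\<close>, with register 4 pointing just behind the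
  code of the prefix \<open>xs\<close>.\<close>

lemma exec_pass_loop:
  assumes p: "arc_step es p f" and "es = xs @ ys" "ready es r" "r 4 = int (3 * length xs)"
  shows "\<exists>t r'. t \<le> 1 + length ys * (1 + steps (pass_body p)) \<and>
    exec (WhileLess 4 3 (pass_body p)) (r, mem es \<sigma>) t
      (r', mem es (fold (\<lambda>(u, v, c). f u v c) (arcs ys) \<sigma>)) \<and> ready es r' \<and> r' 2 = r 2"
  using assms(2-)
proof (induction ys arbitrary: xs r \<sigma>)
  case Nil
  then have "\<not> r 4 < r 3" by (simp add: ready_def)
  from exec.WhileFalse[OF this] show ?case using Nil by (auto simp: arcs_def)
next
  case (Cons e ys)
  obtain u v c where e: "e = (u, v, c)" by (cases e)
  have lt: "r 4 < r 3" using Cons.prems by (simp add: ready_def)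
  obtain r1 where r1: "safe (pass_body p) (r, mem es \<sigma>)"
    "run (pass_body p) (r, mem es \<sigma>) = (r1, mem es (f v u c (f u v c \<sigma>)))"
    "ready es r1" "r1 4 = int (3 * length (xs @ [e]))" "r1 2 = r 2"
    using run_pass_body[OF p, of xs u v c ys r \<sigma>] Cons.prems e by blast
  then obtain t1 where t1: "t1 \<le> steps (pass_body p)"
    "exec (pass_body p) (r, mem es \<sigma>) t1 (r1, mem es (f v u c (f u v c \<sigma>)))"
    using exec_run by metis
  have prem: "es = (xs @ [e]) @ ys" using Cons.prems by simp
  obtain t2 r2 where t2: "t2 \<le> 1 + length ys * (1 + steps (pass_body p))"
    "exec (WhileLess 4 3 (pass_body p)) (r1, mem es (f v u c (f u v c \<sigma>))) t2
      (r2, mem es (fold (\<lambda>(u, v, c). f u v c) (arcs ys) (f v u c (f u v c \<sigma>))))"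
    "ready es r2" "r2 2 = r1 2"
    using Cons.IH[OF prem r1(3,4)] by blast
  have "fold (\<lambda>(u, v, c). f u v c) (arcs (e # ys)) \<sigma>
      = fold (\<lambda>(u, v, c). f u v c) (arcs ys) (f v u c (f u v c \<sigma>))"
    by (simp add: arcs_def e)
  then show ?case
    using exec.WhileTrue[OF lt t1(2) t2(2)] t1(1) t2 r1(5)
    by (intro exI[of _ "1 + t1 + t2"] exI[of _ r2]) auto
qed

text \<open>Register 2 must be kept because it holds \<open>k\<close> for the final
  comparison.\<close>

definition computes :: "edge_list \<Rightarrow> ram \<Rightarrow> nat \<Rightarrow> (arrays \<Rightarrow> arrays) \<Rightarrow> bool" where
  "computes es p T F \<longleftrightarrow> (\<forall>r \<sigma>. ready es r \<longrightarrow> (\<exists>t r'. t \<le> T \<and>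
     exec p (r, mem es \<sigma>) t (r', mem es (F \<sigma>)) \<and> ready es r' \<and> r' 2 = r 2))"

text \<open>The constant 2 pays for resetting the input pointer and for the last, failing loop
  test.\<close>

lemma computes_pass:
  assumes "arc_step es p f"
  shows "computes es (pass p) (2 + length es * (1 + steps (pass_body p)))
    (fold (\<lambda>(u, v, c). f u v c) (arcs es))"
  unfolding computes_def
proof (intro allI impI)
  fix r \<sigma> assume r: "ready es r"
  let ?r = "r(4 := 0)"
  obtain t r' where *: "t \<le> 1 + length es * (1 + steps (pass_body p))"
    "exec (WhileLess 4 3 (pass_body p)) (?r, mem es \<sigma>) t
      (r', mem es (fold (\<lambda>(u, v, c). f u v c) (arcs es) \<sigma>))" "ready es r'" "r' 2 = ?r 2"
    using exec_pass_loop[OF assms, of "[]" es ?r \<sigma>] r by (auto simp: ready_def)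
  then show "\<exists>t r'. t \<le> 2 + length es * (1 + steps (pass_body p)) \<and>
     exec (pass p) (r, mem es \<sigma>) t (r', mem es (fold (\<lambda>(u, v, c). f u v c) (arcs es) \<sigma>)) \<and>
     ready es r' \<and> r' 2 = r 2"
    using exec.Seq[OF exec.Const *(2)] unfolding pass_def
    by (intro exI[of _ "1 + t"] exI[of _ r']) auto
qed

lemma computes_mono: "computes es p T F \<Longrightarrow> T \<le> T' \<Longrightarrow> computes es p T' F"
  unfolding computes_def by (meson order_trans)

lemma computes_Seq:
  assumes "computes es p T F" "computes es q T' F'"
  shows "computes es (Seq p q) (T + T') (\<lambda>\<sigma>. F' (F \<sigma>))"
  unfolding computes_def
proof (intro allI impI)
  fix r \<sigma> assume r: "ready es r"
  obtain t r' where 1: "t \<le> T" "exec p (r, mem es \<sigma>) t (r', mem es (F \<sigma>))" "ready es r'" "r' 2 = r 2"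
    using assms(1) r unfolding computes_def by blast
  obtain t' r'' where 2: "t' \<le> T'" "exec q (r', mem es (F \<sigma>)) t' (r'', mem es (F' (F \<sigma>)))"
    "ready es r''" "r'' 2 = r' 2"
    using assms(2) 1(3) unfolding computes_def by blast
  show "\<exists>t r'. t \<le> T + T' \<and> exec (Seq p q) (r, mem es \<sigma>) t (r', mem es (F' (F \<sigma>))) \<and>
     ready es r' \<and> r' 2 = r 2"
    using exec.Seq[OF 1(2) 2(2)] 1 2 by (intro exI[of _ "t + t'"] exI[of _ r'']) auto
qed

section \<open>Programs evaluated at each arc\<close>

definition if_blue :: "ram \<Rightarrow> ram \<Rightarrow> ram" where "if_blue p q = IfLess 9 5 p q"

definition if_lex_less :: "nat \<Rightarrow> nat \<Rightarrow> nat \<Rightarrow> ram \<Rightarrow> ram \<Rightarrow> ram" where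
  "if_lex_less i a b p q = Seq (get 12 i a) (Seq (get 13 i b)
     (IfLess 12 13 p (IfLess 13 12 q (IfLess a b p q))))"

text \<open>Arrays: 0 \<open>bdeg\<close>, 1 red degree, 2 \<open>links\<close>, 3 \<open>below\<close>, 4 \<open>cost\<close>,
  5 number of cheaper vertices in the red clique; cell 0 of array 7 is the total.\<close>

definition expr_bdeg :: ram where "expr_bdeg = if_blue (Const 11 1) (Const 11 0)"
definition expr_rdeg :: ram where "expr_rdeg = if_blue (Const 11 0) (Const 11 1)"
definition expr_links :: ram where
  "expr_links = if_blue (Seq (get 12 1 8) (IfLess 6 12 (Const 11 1) (Const 11 0))) (Const 11 0)"
definition expr_rank :: "nat \<Rightarrow> ram" where
  "expr_rank i = if_blue (Const 11 0) (if_lex_less i 8 7 (Const 11 1) (Const 11 0))"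
definition expr_cost :: ram where
  "expr_cost = if_blue (Const 11 0) (Seq (get 12 0 7) (Seq (get 13 0 8) (Seq (Add 12 12 13)
     (Seq (Const 13 3) (Seq (get 14 2 7) (Seq (Const 11 0)
       (IfLess 12 13 (IfLess 6 14 (Const 11 0) (if_lex_less 0 7 8 (get 11 3 8) (get 11 0 8)))
         (if_lex_less 0 7 8 (get 11 3 8) (get 11 0 8)))))))))"

lemma arc_expr_bdeg: "arc_expr es expr_bdeg (\<lambda>\<sigma> u v c. if c = Blue then 1 else 0)"
  by (auto simp: arc_expr_def expr_bdeg_def if_blue_def ready_def at_arc_def split: colour.splits)

lemma arc_expr_rdeg: "arc_expr es expr_rdeg (\<lambda>\<sigma> u v c. if c = Red then 1 else 0)"
  by (auto simp: arc_expr_def expr_rdeg_def if_blue_def ready_def at_arc_def split: colour.splits)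

lemma arc_expr_links:
  "arc_expr es expr_links (\<lambda>\<sigma> u v c. if c = Blue \<and> 0 < \<sigma> 1 v then 1 else 0)"
  by (auto simp: arc_expr_def expr_links_def if_blue_def ready_def at_arc_def split: colour.splits)

lemma arc_expr_rank:
  "i < 8 \<Longrightarrow> arc_expr es (expr_rank i) (\<lambda>\<sigma> u v c. if c = Red \<and> lex_less (\<sigma> i) v u then 1 else 0)"
  by (auto simp: arc_expr_def expr_rank_def if_blue_def if_lex_less_def lex_less_def ready_def at_arc_def split: colour.splits)

lemma arc_expr_cost:
  "arc_expr es expr_cost (\<lambda>\<sigma> u v c. if c = Blue \<or> 0 < \<sigma> 2 u \<and> \<sigma> 0 u + \<sigma> 0 v < 3 then 0
     else if lex_less (\<sigma> 0) u v then \<sigma> 3 v else \<sigma> 0 v)"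
  by (auto simp: arc_expr_def expr_cost_def if_blue_def if_lex_less_def lex_less_def ready_def at_arc_def split: colour.splits)

text \<open>Clearing the cost cell after adding it makes every vertex count once, although it is the tail of many arcs.\<close>

definition collect :: ram where
  "collect = Seq (get 12 5 7) (Seq (get 11 4 7) (Seq (put 4 7 6)
     (IfLess 6 12 (Move 12 12) (Seq (get 12 7 6) (Seq (Add 12 12 11) (put 7 6 12))))))"

definition collect_step :: "nat \<Rightarrow> nat \<Rightarrow> colour \<Rightarrow> arrays \<Rightarrow> arrays" where
  "collect_step u v c \<sigma> = \<sigma>(4 := (\<sigma> 4)(u := 0),
     7 := (\<sigma> 7)(0 := \<sigma> 7 0 + (if 0 < \<sigma> 5 u then 0 else \<sigma> 4 u)))"

lemma arc_step_collect: "arc_step es collect collect_step"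
  by (auto simp: arc_step_def collect_def collect_step_def ready_def at_arc_def fun_upd_idem)

text \<open>Since \<open>g\<close> does not read array \<open>i\<close>, every increment can be
  evaluated in the initial state.\<close>

lemma fold_add_to:
  assumes "\<And>\<sigma> y u v c. g (\<sigma>(i := y)) u v c = g \<sigma> u v c"
  shows "fold (\<lambda>(u, v, c). add_to i g u v c) as \<sigma> =
    \<sigma>(i := \<lambda>u. \<sigma> i u + (\<Sum>(u', v, c)\<leftarrow>as. if u' = u then g \<sigma> u v c else 0))"
proof (induction as arbitrary: \<sigma>)
  case (Cons a as)
  obtain u v c where a: "a = (u, v, c)" by (cases a)
  let ?\<sigma> = "add_to i g u v c \<sigma>"
  have g: "g ?\<sigma> = g \<sigma>" by (simp add: fun_eq_iff add_to_def assms)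
  have "fold (\<lambda>(u, v, c). add_to i g u v c) (a # as) \<sigma> =
    ?\<sigma>(i := \<lambda>u. ?\<sigma> i u + (\<Sum>(u', v, c)\<leftarrow>as. if u' = u then g \<sigma> u v c else 0))"
    using Cons.IH[of ?\<sigma>] unfolding g by (simp add: a fun_upd_def)
  also have "\<dots> =
    \<sigma>(i := \<lambda>u. \<sigma> i u + (\<Sum>(u', v, c)\<leftarrow>a # as. if u' = u then g \<sigma> u v c else 0))"
    by (auto simp: a add_to_def fun_eq_iff)
  finally show ?case .
qed simp

lemma fold_collect_step:
  "fold (\<lambda>(u, v, c). collect_step u v c) as \<sigma> 7 0 =
    \<sigma> 7 0 + (\<Sum>u\<in>fst ` set as. if 0 < \<sigma> 5 u then 0 else \<sigma> 4 u)"
proof (induction as arbitrary: \<sigma>)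
  case (Cons a as)
  obtain u v c where a: "a = (u, v, c)" by (cases a)
  let ?h = "\<lambda>u. if 0 < \<sigma> 5 u then 0 else \<sigma> 4 u"
  let ?\<sigma> = "collect_step u v c \<sigma>"
  \<comment> \<open>After the first arc the cost cell of \<open>u\<close> is 0, so \<open>u\<close>
    drops out of the remaining sum.\<close>
  have "(\<Sum>x\<in>fst ` set as. if 0 < ?\<sigma> 5 x then 0 else ?\<sigma> 4 x) = (\<Sum>x\<in>fst ` set as. if x = u then 0 else ?h x)"
    by (rule sum.cong) (auto simp: collect_step_def)
  also have "\<dots> = (\<Sum>x\<in>fst ` set as - {u}. ?h x)"
    by (rule sum.mono_neutral_cong_right) auto
  finally have "fold (\<lambda>(u, v, c). collect_step u v c) (a # as) \<sigma> 7 0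
      = ?\<sigma> 7 0 + (\<Sum>x\<in>fst ` set as - {u}. ?h x)"
    by (simp add: a Cons.IH)
  moreover have "?\<sigma> 7 0 = \<sigma> 7 0 + ?h u" by (simp add: collect_step_def)
  moreover have "sum ?h (insert u (fst ` set as)) = ?h u + (\<Sum>x\<in>fst ` set as - {u}. ?h x)"
    by (simp add: sum.insert_remove)
  ultimately show ?case unfolding a by (simp only: list.set image_insert fst_conv add.assoc)
qed simp

lemma lex_less_int: "lex_less (\<lambda>v. int (f v)) = lex_less f"
  by (auto simp: lex_less_def fun_eq_iff)

lemma sum_indicator_card: "finite A \<Longrightarrow> (\<Sum>v\<in>A. if P v then 1 else 0) = int (card {v \<in> A. P v})"
  by (simp add: sum.If_cases Int_def)

lemma set_arcs: "(u, v, c) \<in> set (arcs es) \<longleftrightarrow> (u, v, c) \<in> set es \<or> (v, u, c) \<in> set es"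
  by (force simp: arcs_def)

lemma distinct_arcs:
  assumes "distinct (map (\<lambda>(u, v, c). {u, v}) es)" "\<forall>(u, v, c)\<in>set es. u \<noteq> v"
  shows "distinct (arcs es)"
  using assms
proof (induction es)
  case (Cons e es)
  obtain u v c where e: "e = (u, v, c)" by (cases e)
  have n: "(u, v, c) \<notin> set es" "(v, u, c) \<notin> set es"
    using Cons.prems(1) by (force simp: e insert_commute)+
  have "arcs (e # es) = (u, v, c) # (v, u, c) # arcs es" by (simp add: arcs_def e)
  then show ?case using Cons n by (simp add: set_arcs e)
qed (simp add: arcs_def)

section \<open>Values computed by the passes\<close>

locale class_T_input = class_T_graph G for G :: "nat bgraph" +
  fixes es :: edge_list
  assumes edge_list: "edge_list_of G es"
begin

lemma nbh_arcs: "v \<in> nbh G c u \<longleftrightarrow> (u, v, c) \<in> set (arcs es)"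
  using edge_list by (cases c) (auto simp: nbh_def set_arcs edge_list_of_def doubleton_eq_iff)

lemma distinct_arcs_es: "distinct (arcs es)"
proof (rule distinct_arcs)
  show "distinct (map (\<lambda>(u, v, c). {u, v}) es)" using edge_list by (simp add: edge_list_of_def)
  show "\<forall>(u, v, c)\<in>set es. u \<noteq> v" using nbh_arcs irrefl set_arcs by fastforce
qed

lemma length_es: "length es = card (edges G)"
proof -
  note c = edge_list[unfolded edge_list_of_def, THEN conjunct2, THEN conjunct2]
  note bl = c[THEN conjunct1] c[THEN conjunct2]
  have "edges G = set (map (\<lambda>(u, v, c). {u, v}) es)"
  proof
    show "edges G \<subseteq> set (map (\<lambda>(u, v, c). {u, v}) es)"
    proof
      fix e assume "e \<in> edges G"
      then obtain u v c where "e = {u, v}" "(u, v, c) \<in> set es"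
        unfolding edges_def bl by blast
      then show "e \<in> set (map (\<lambda>(u, v, c). {u, v}) es)" by force
    qed
    have "{u, v} \<in> edges G" if "(u, v, c) \<in> set es" for u v c
      using that unfolding edges_def bl by (cases c) blast+
    then show "set (map (\<lambda>(u, v, c). {u, v}) es) \<subseteq> edges G" by auto
  qed
  then show ?thesis
    using edge_list distinct_card[of "map (\<lambda>(u, v, c). {u, v}) es"] by (simp add: edge_list_of_def)
qed

text \<open>Every neighbour of \<open>u\<close> is the head of exactly one arc with tail
  \<open>u\<close>.\<close>

lemma arc_sum:
  fixes h :: "nat \<Rightarrow> colour \<Rightarrow> int"
  shows "(\<Sum>(u', v, c)\<leftarrow>arcs es. if u' = u then h v c else 0)
    = (\<Sum>v\<in>B u. h v Blue) + (\<Sum>v\<in>R u. h v Red)"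
proof -
  let ?g = "\<lambda>(u', v, c). if u' = u then h v c else 0"
  let ?A = "(\<lambda>v. (u, v, Blue)) ` B u" and ?A' = "(\<lambda>v. (u, v, Red)) ` R u"
  have "(\<Sum>p\<leftarrow>arcs es. ?g p) = sum ?g (set (arcs es))"
    by (rule sum_list_distinct_conv_sum_set[OF distinct_arcs_es])
  also have "\<dots> = sum ?g (?A \<union> ?A')"
  proof (rule sum.mono_neutral_right)
    show "?A \<union> ?A' \<subseteq> set (arcs es)" using nbh_arcs by auto
    show "\<forall>p\<in>set (arcs es) - (?A \<union> ?A'). ?g p = 0"
    proof (intro ballI)
      fix p assume p: "p \<in> set (arcs es) - (?A \<union> ?A')"
      obtain u' v c where "p = (u', v, c)" by (cases p)
      then show "?g p = 0" using p nbh_arcs[of v c u] by (cases c) auto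
    qed
  qed simp
  also have "\<dots> = sum ?g ?A + sum ?g ?A'" by (rule sum.union_disjoint) auto
  also have "sum ?g ?A = (\<Sum>v\<in>B u. h v Blue)" by (subst sum.reindex) (auto simp: inj_on_def)
  also have "sum ?g ?A' = (\<Sum>v\<in>R u. h v Red)" by (subst sum.reindex) (auto simp: inj_on_def)
  finally show ?thesis .
qed

lemma fold_add_to_arcs:
  assumes "\<And>\<sigma> y u v c. g (\<sigma>(i := y)) u v c = g \<sigma> u v c" "\<sigma> i = (\<lambda>_. 0)"
    and "\<And>u. (\<Sum>v\<in>B u. g \<sigma> u v Blue) + (\<Sum>v\<in>R u. g \<sigma> u v Red) = F u"
  shows "fold (\<lambda>(u, v, c). add_to i g u v c) (arcs es) \<sigma> = \<sigma>(i := F)"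
  unfolding fold_add_to[OF assms(1)] arc_sum assms(2,3) by simp

definition total_cost :: nat where "total_cost = (\<Sum>v\<in>winners. cost v)"

text \<open>A vertex that is no tail has no red neighbour and costs 0, and the winners are the
  vertices with no cheaper one in their clique.\<close>

lemma sum_collected:
  "(\<Sum>u\<in>fst ` set (arcs es). if 0 < int (card {w \<in> R u. lex_less cost w u}) then 0 else int (cost u))
    = int total_cost"
proof -
  have "(\<Sum>u\<in>fst ` set (arcs es). if 0 < int (card {w \<in> R u. lex_less cost w u}) then 0 else int (cost u))
    = (\<Sum>u\<in>verts G. if 0 < int (card {w \<in> R u. lex_less cost w u}) then 0 else int (cost u))"
  proof (rule sum.mono_neutral_left)
    show "fst ` set (arcs es) \<subseteq> verts G" using nbh_arcs in_verts by fastforce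
    have "R v = {}" if "v \<notin> fst ` set (arcs es)" for v
      using that nbh_arcs[of _ Red v] by force
    then show "\<forall>u\<in>verts G - fst ` set (arcs es).
      (if 0 < int (card {w \<in> R u. lex_less cost w u}) then 0 else int (cost u)) = 0"
      by (auto simp: cost_def)
  qed (rule finite_verts)
  also have "\<dots> = (\<Sum>u\<in>winners. int (cost u))"
    using finite_verts by (intro sum.mono_neutral_cong_right) (auto simp: winners_def card_gt_0_iff)
  finally show ?thesis by (simp add: total_cost_def)
qed

end

section \<open>The complete program and its running time\<close>

definition main_passes :: ram where
  "main_passes =
     Seq (pass (accumulate 0 expr_bdeg)) (Seq (pass (accumulate 1 expr_rdeg))
    (Seq (pass (accumulate 2 expr_links)) (Seq (pass (accumulate 3 (expr_rank 0)))
    (Seq (pass (accumulate 4 expr_cost)) (Seq (pass (accumulate 5 (expr_rank 4))) (pass collect))))))"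

text \<open>The summand 7 pays for one loop test in each of the seven passes.\<close>

definition iteration_steps :: nat where
  "iteration_steps = 7 + steps (pass_body (accumulate 0 expr_bdeg)) + steps (pass_body (accumulate 1 expr_rdeg))
    + steps (pass_body (accumulate 2 expr_links)) + steps (pass_body (accumulate 3 (expr_rank 0)))
    + steps (pass_body (accumulate 4 expr_cost)) + steps (pass_body (accumulate 5 (expr_rank 4)))
    + steps (pass_body collect)"

definition init_registers :: ram where
  "init_registers = Seq (Const 5 1) (Seq (Const 6 0) (Seq (Add 3 1 1) (Add 3 3 1)))"

definition answer :: ram where
  "answer = Seq (get 12 7 6) (IfLess 2 12 (Const 0 0) (Const 0 1))"

definition solver :: ram where
  "solver = Seq init_registers (Seq main_passes answer)"

context class_T_input
begin

lemma computes_main_passes: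
  "\<exists>F. computes es main_passes (14 + length es * iteration_steps) F \<and> F (\<lambda>_ _. 0) 7 0 = int total_cost"
proof -
  let ?f = "\<lambda>i g. fold (\<lambda>(u, v, c). add_to i g u v c) (arcs es)"
  let ?g0 = "\<lambda>(\<sigma>::arrays) (u::nat) (v::nat) c. if c = Blue then 1 else 0 :: int"
  let ?g1 = "\<lambda>(\<sigma>::arrays) (u::nat) (v::nat) c. if c = Red then 1 else 0 :: int"
  let ?g2 = "\<lambda>(\<sigma>::arrays) (u::nat) v c. if c = Blue \<and> 0 < \<sigma> 1 v then 1 else 0 :: int"
  let ?r = "\<lambda>i (\<sigma>::arrays) u v c. if c = Red \<and> lex_less (\<sigma> i) v u then 1 else 0 :: int"
  let ?g4 = "\<lambda>(\<sigma>::arrays) u v c. if c = Blue \<or> 0 < \<sigma> 2 u \<and> \<sigma> 0 u + \<sigma> 0 v < 3 then 0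
     else if lex_less (\<sigma> 0) u v then \<sigma> 3 v else \<sigma> 0 v"
  \<comment> \<open>The contents of the arrays after each of the first six passes; each pass reads
    only arrays completed before it, apart from its own accumulator.\<close>
  define s0 :: arrays where "s0 = (\<lambda>_ _. 0)(0 := \<lambda>u. int (bdeg u))"
  define s1 where "s1 = s0(1 := \<lambda>u. int (card (R u)))"
  define s2 where "s2 = s1(2 := \<lambda>u. int (links u))"
  define s3 where "s3 = s2(3 := \<lambda>u. int (below u))"
  define s4 where "s4 = s3(4 := \<lambda>u. int (cost u))"
  define s5 where "s5 = s4(5 := \<lambda>u. int (card {w \<in> R u. lex_less cost w u}))"
  have 0: "?f 0 ?g0 (\<lambda>_ _. 0) = s0"
    unfolding s0_def by (rule fold_add_to_arcs) (auto simp: bdeg_def)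
  have 1: "?f 1 ?g1 s0 = s1"
    unfolding s1_def by (rule fold_add_to_arcs) (auto simp: s0_def)
  have 2: "?f 2 ?g2 s1 = s2"
    unfolding s2_def
    by (rule fold_add_to_arcs) (auto simp: s1_def s0_def links_def sum_indicator_card card_gt_0_iff)
  have 3: "?f 3 (?r 0) s2 = s3"
    unfolding s3_def
    by (rule fold_add_to_arcs) (auto simp: s2_def s1_def s0_def below_def sum_indicator_card lex_less_int)
  have 4: "?f 4 ?g4 s3 = s4"
    unfolding s4_def
    by (rule fold_add_to_arcs) (auto simp: s3_def s2_def s1_def s0_def cost_def lex_less_int intro!: sum.cong)
  have 5: "?f 5 (?r 4) s4 = s5"
    unfolding s5_def
    by (rule fold_add_to_arcs) (auto simp: s4_def s3_def s2_def s1_def s0_def sum_indicator_card lex_less_int)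
  have 6: "fold (\<lambda>(u, v, c). collect_step u v c) (arcs es) s5 7 0 = int total_cost"
  proof -
    have e: "s5 5 = (\<lambda>u. int (card {w \<in> R u. lex_less cost w u}))" "s5 4 = (\<lambda>u. int (cost u))" "s5 7 0 = 0"
      by (simp_all add: s5_def s4_def s3_def s2_def s1_def s0_def)
    show ?thesis unfolding fold_collect_step e by (simp only: sum_collected add_0)
  qed
  note P = computes_pass[OF arc_step_accumulate]
  have c: "computes es (pass (accumulate 0 expr_bdeg)) (2 + length es * (1 + steps (pass_body (accumulate 0 expr_bdeg)))) (?f 0 ?g0)"
    "computes es (pass (accumulate 1 expr_rdeg)) (2 + length es * (1 + steps (pass_body (accumulate 1 expr_rdeg)))) (?f 1 ?g1)"
    "computes es (pass (accumulate 2 expr_links)) (2 + length es * (1 + steps (pass_body (accumulate 2 expr_links)))) (?f 2 ?g2)"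
    "computes es (pass (accumulate 3 (expr_rank 0))) (2 + length es * (1 + steps (pass_body (accumulate 3 (expr_rank 0))))) (?f 3 (?r 0))"
    "computes es (pass (accumulate 4 expr_cost)) (2 + length es * (1 + steps (pass_body (accumulate 4 expr_cost)))) (?f 4 ?g4)"
    "computes es (pass (accumulate 5 (expr_rank 4))) (2 + length es * (1 + steps (pass_body (accumulate 5 (expr_rank 4))))) (?f 5 (?r 4))"
    by (rule P arc_expr_bdeg arc_expr_rdeg arc_expr_links arc_expr_rank arc_expr_cost | simp)+
  have main: "computes es main_passes (14 + length es * iteration_steps)
    (\<lambda>\<sigma>. fold (\<lambda>(u, v, c). collect_step u v c) (arcs es)
      (?f 5 (?r 4) (?f 4 ?g4 (?f 3 (?r 0) (?f 2 ?g2 (?f 1 ?g1 (?f 0 ?g0 \<sigma>)))))))"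
    by (rule computes_mono[OF computes_Seq[OF c(1) computes_Seq[OF c(2) computes_Seq[OF c(3)
      computes_Seq[OF c(4) computes_Seq[OF c(5) computes_Seq[OF c(6) computes_pass[OF arc_step_collect]]]]]],
      folded main_passes_def]]) (simp add: iteration_steps_def algebra_simps)
  show ?thesis
    by (rule exI, rule conjI[OF main]) (simp only: 0 1 2 3 4 5 6)
qed

lemma solver_correct:
  "\<exists>t s. exec solver (input_state (card (verts G)) es k) t s \<and>
     outputs s (two_colored_P4_deletion G k) \<and>
     t \<le> (100 + iteration_steps) * (card (verts G) * card (edges G) + 1)"
proof -
  let ?r = "(\<lambda>_. 0)(0 := int (card (verts G)), 1 := int (length es), 2 := k)"
  have init: "input_state (card (verts G)) es k = (?r, mem es (\<lambda>_ _. 0))"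
    by (simp add: input_state_def mem_def fun_eq_iff Let_def flip: input_code_def)
  define r1 :: "nat \<Rightarrow> int" where "r1 = ?r(5 := 1, 6 := 0, 3 := int (3 * length es))"
  have "run init_registers (?r, M) = (r1, M) \<and> safe init_registers (?r, M)" for M
    by (auto simp: init_registers_def r1_def fun_eq_iff)
  then obtain t1 where t1: "t1 \<le> steps init_registers"
    "exec init_registers (?r, mem es (\<lambda>_ _. 0)) t1 (r1, mem es (\<lambda>_ _. 0))"
    using exec_run by metis
  have "ready es r1" by (simp add: ready_def r1_def)
  then obtain t2 r2 \<sigma> where t2: "t2 \<le> 14 + length es * iteration_steps"
    "exec main_passes (r1, mem es (\<lambda>_ _. 0)) t2 (r2, mem es \<sigma>)" "ready es r2" "r2 2 = k"
    "\<sigma> 7 0 = int total_cost"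
    using computes_main_passes unfolding computes_def by (force simp: r1_def)
  have "safe answer (r2, mem es \<sigma>)"
    using t2(3) by (simp add: answer_def ready_def)
  then obtain t3 where t3: "t3 \<le> steps answer"
    "exec answer (r2, mem es \<sigma>) t3 (run answer (r2, mem es \<sigma>))"
    using exec_run by metis
  have out: "outputs (run answer (r2, mem es \<sigma>)) (two_colored_P4_deletion G k)"
    using t2(3,4,5) two_colored_P4_deletion_iff[of k]
    by (auto simp: answer_def ready_def outputs_def total_cost_def)
  \<comment> \<open>One edge already forces two vertices, so a bound linear in the number of edges
    suffices.\<close>
  have "length es \<le> card (verts G) * card (edges G)"
  proof (cases "card (edges G) = 0")
    case False
    then obtain e where "e \<in> edges G" by fastforce
    then have "e \<subseteq> verts G" "card e = 2" using bicolored unfolding bicolored_graph_def by auto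
    then have "2 \<le> card (verts G)" using card_mono[OF finite_verts] by metis
    then show ?thesis using length_es by simp
  qed (simp add: length_es)
  then have "length es * iteration_steps \<le> card (verts G) * card (edges G) * iteration_steps"
    by (rule mult_right_mono) simp
  \<comment> \<open>A generous bound, which together with the 14 steps from the passes makes
    100.\<close>
  moreover have "steps init_registers + steps answer \<le> 86"
    by (simp add: init_registers_def answer_def get_def address_def)
  ultimately have "t1 + (t2 + t3) \<le> 100 + card (verts G) * card (edges G) * iteration_steps"
    using t1(1) t2(1) t3(1) by linarith
  also have "\<dots> \<le> (100 + iteration_steps) * (card (verts G) * card (edges G) + 1)"
    by (simp add: algebra_simps)
  finally have "t1 + (t2 + t3) \<le> (100 + iteration_steps) * (card (verts G) * card (edges G) + 1)" .
  moreover have "exec solver (input_state (card (verts G)) es k) (t1 + (t2 + t3)) (run answer (r2, mem es \<sigma>))"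
    unfolding solver_def init by (intro exec.Seq[OF t1(2)] exec.Seq[OF t2(2)] t3(2))
  ultimately show ?thesis using out by blast
qed

end

theorem theorem26:
  shows "\<exists>(P :: ram) (C :: nat). \<forall>(G :: nat bgraph) es (k :: int).
    G \<in> class_T \<and> edge_list_of G es \<longrightarrow>
      (\<exists>t s. exec P (input_state (card (verts G)) es k) t s \<and>
             outputs s (two_colored_P4_deletion G k) \<and>
             t \<le> C * (card (verts G) * card (edges G) + 1))"
proof (rule exI[of _ solver], rule exI[of _ "100 + iteration_steps"], intro allI impI)
  fix G :: "nat bgraph" and es and k :: int
  assume "G \<in> class_T \<and> edge_list_of G es"
  then interpret class_T_input G es by unfold_locales simp_all
  show "\<exists>t s. exec solver (input_state (card (verts G)) es k) t s \<and>
             outputs s (two_colored_P4_deletion G k) \<and>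
             t \<le> (100 + iteration_steps) * (card (verts G) * card (edges G) + 1)"
    by (rule solver_correct)
qed

end
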